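(* Let $\lambda:\mathbb{N}^n\to\mathbb{R}$ be an arbitrary map. Then $\lambda$ is a multivariate multiplier sequence if and only if there exist univariate multiplier sequences $\lambda_i:\mathbb{N}\to\mathbb{R}$, $1\le i\le n$, such that $$\lambda(\alpha)=\lambda_1(\alpha_1)\lambda_2(\alpha_2)\cdots\lambda_n(\alpha_n)\quad\text{for all }\alpha=(\alpha_1,\ldots,\alpha_n)\in\mathbb{N}^n,$$ and either $\lambda(\alpha)\lambda(\beta)\ge 0$ for all $\alpha,\beta\in\mathbb{N}^n$, or $(-1)^{|\alpha|+|\beta|}\lambda(\alpha)\lambda(\beta)\ge 0$ for all $\alpha,\beta\in\mathbb{N}^n$.
   Context: $\mathbb{N}=\{0,1,2,\ldots\}$ and $|\alpha|=\alpha_1+\cdots+\alpha_n$. A polynomial $f\in\mathbb{R}[z_1,\ldots,z_n]$ is real stable if $f(z_1,\ldots,z_n)\neq 0$ whenever $\operatorname{Im}(z_j)>0$ for all $1\le j\le n$; $\mathcal{H}_n(\mathbb{R})$ denotes the set of real stable polynomials in $n$ variables (for $n=1$: nonzero real polynomials with only real zeros). A function $\lambda:\mathbb{N}^n\to\mathbb{R}$ is a (multivariate) multiplier sequence if the linear operator $T$ defined by $T(z^\alpha)=\lambda(\alpha)z^\alpha$ for all $\alpha\in\mathbb{N}^n$ satisfies $T(\mathcal{H}_n(\mathbb{R}))\subseteq\mathcal{H}_n(\mathbb{R})\cup\{0\}$. A univariate multiplier sequence is the case $n=1$. *)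

theory Defs
  imports "HOL-Analysis.Analysis" "HOL-Library.Poly_Mapping"
begin

text \<open>
  Multi-indices in \<open>\<nat>\<^sup>n\<close> are vectors of type \<open>nat ^ 'n\<close>, with \<open>n = CARD('n) \<ge> 1\<close>. The polynomial ring
  \<open>\<real>[z\<^sub>1, \<dots>, z\<^sub>n]\<close> is the monoid algebra of \<open>\<nat>\<^sup>n\<close> over \<open>\<real>\<close>: finitely supported coefficient
  functions with the convolution product of \<open>Poly_Mapping\<close>. The monomial \<open>z\<^sup>\<alpha>\<close> is
  \<open>Poly_Mapping.single \<alpha> 1\<close>.
\<close>

type_synonym 'n real_mpoly = "(nat ^ 'n) \<Rightarrow>\<^sub>0 real"

definition eval_mpoly :: "'n::finite real_mpoly \<Rightarrow> complex ^ 'n \<Rightarrow> complex" where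
  "eval_mpoly f z =
     (\<Sum>\<alpha>\<in>Poly_Mapping.keys f.
        complex_of_real (Poly_Mapping.lookup f \<alpha>) * (\<Prod>j\<in>UNIV. (z $ j) ^ (\<alpha> $ j)))"

definition real_stable :: "'n::finite real_mpoly \<Rightarrow> bool" where
  "real_stable f \<longleftrightarrow> (\<forall>z. (\<forall>j. Im (z $ j) > 0) \<longrightarrow> eval_mpoly f z \<noteq> 0)"

text \<open>
  The linear operator determined by \<open>z\<^sup>\<alpha> \<mapsto> \<lambda>(\<alpha>) z\<^sup>\<alpha>\<close>; the lemma \<open>diag_op_unique\<close>
  below shows that it is the only one.
\<close>

definition diag_op :: "(nat ^ 'n \<Rightarrow> real) \<Rightarrow> 'n::finite real_mpoly \<Rightarrow> 'n real_mpoly" where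
  "diag_op l f = Poly_Mapping.mapp (\<lambda>\<alpha> c. l \<alpha> * c) f"

definition multiplier_sequence :: "(nat ^ 'n::finite \<Rightarrow> real) \<Rightarrow> bool" where
  "multiplier_sequence l \<longleftrightarrow> diag_op l ` {f. real_stable f} \<subseteq> {f. real_stable f} \<union> {0}"

text \<open>The case \<open>n = 1\<close>, with \<open>nat ^ 1\<close> identified with \<open>nat\<close>.\<close>

definition univariate_multiplier_sequence :: "(nat \<Rightarrow> real) \<Rightarrow> bool" where
  "univariate_multiplier_sequence l \<longleftrightarrow> multiplier_sequence (\<lambda>\<alpha> :: nat ^ 1. l (\<alpha> $ 1))"

definition index_size :: "nat ^ 'n::finite \<Rightarrow> nat" where
  "index_size \<alpha> = (\<Sum>i\<in>UNIV. \<alpha> $ i)"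

lemma lookup_diag_op [simp]:
  "Poly_Mapping.lookup (diag_op l f) \<alpha> = l \<alpha> * Poly_Mapping.lookup f \<alpha>"
  by (auto simp: diag_op_def lookup_mapp when_def in_keys_iff)

lemma diag_op_add: "diag_op l (f + g) = diag_op l f + diag_op l g"
  by (rule poly_mapping_eqI) (simp add: lookup_add algebra_simps)

lemma diag_op_single:
  "diag_op l (Poly_Mapping.single \<alpha> c) = Poly_Mapping.single \<alpha> (l \<alpha> * c)"
  by (rule poly_mapping_eqI) (simp add: lookup_single when_def)

lemma diag_op_scale: "diag_op l (Poly_Mapping.map ((*) c) f) = Poly_Mapping.map ((*) c) (diag_op l f)"
  by (rule poly_mapping_eqI) (simp add: Poly_Mapping.map.rep_eq when_def)

lemma diag_op_unique:
  fixes T :: "'n::finite real_mpoly \<Rightarrow> 'n real_mpoly"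
  assumes add: "\<And>f g. T (f + g) = T f + T g"
    and scale: "\<And>c f. T (Poly_Mapping.map ((*) c) f) = Poly_Mapping.map ((*) c) (T f)"
    and monom: "\<And>\<alpha>. T (Poly_Mapping.single \<alpha> 1) = Poly_Mapping.map ((*) (l \<alpha>)) (Poly_Mapping.single \<alpha> 1)"
  shows "T = diag_op l"
proof
  fix f :: "'n real_mpoly"
  have map_single: "Poly_Mapping.map ((*) c) (Poly_Mapping.single \<alpha> d) = Poly_Mapping.single \<alpha> (c * d)"
    for c d :: real and \<alpha> :: "nat ^ 'n"
    by (rule poly_mapping_eqI) (auto simp: Poly_Mapping.map.rep_eq lookup_single when_def)
  have single: "T (Poly_Mapping.single \<alpha> c) = diag_op l (Poly_Mapping.single \<alpha> c)" for \<alpha> c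
    using scale[of c "Poly_Mapping.single \<alpha> 1"] monom[of \<alpha>]
    by (simp add: map_single diag_op_single mult.commute)
  have zero: "T 0 = 0"
    using add[of 0 0] by simp
  have sum: "T (\<Sum>\<alpha>\<in>A. g \<alpha>) = (\<Sum>\<alpha>\<in>A. T (g \<alpha>))" for g and A :: "(nat ^ 'n) set"
    by (induction A rule: infinite_finite_induct) (simp_all add: zero add)
  have sum': "diag_op l (\<Sum>\<alpha>\<in>A. g \<alpha>) = (\<Sum>\<alpha>\<in>A. diag_op l (g \<alpha>))" for g and A :: "(nat ^ 'n) set"
    by (rule poly_mapping_eqI) (simp add: lookup_sum sum_distrib_left)
  have "f = (\<Sum>\<alpha>\<in>Poly_Mapping.keys f. Poly_Mapping.single \<alpha> (Poly_Mapping.lookup f \<alpha>))"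
    by (rule poly_mapping_eqI) (auto simp: lookup_sum lookup_single when_def in_keys_iff)
  then show "T f = diag_op l f"
    by (metis (no_types, lifting) sum sum' single sum.cong)
qed

end

theory Submission
  imports Defs "HOL-Complex_Analysis.Great_Picard"
    "HOL-Computational_Algebra.Fundamental_Theorem_Algebra"
begin

text \<open>
  A univariate multiplier sequence \<open>m\<close> of constant sign sends \<open>(1 + x)\<^sup>N\<close>
  to a polynomial with only nonpositive zeros. Grace--Walsh--Szego then shows that, up to degree
  \<open>N\<close>, it preserves nonvanishing on the upper half-plane for complex polynomials, hence
  may be applied to each variable separately; the zeros are first pushed off \<open>0\<close> and
  \<open>\<infinity>\<close>, so that no intermediate polynomial vanishes identically, and Hurwitz' theorem
  removes the perturbation. Alternating signs reduce to constant ones by \<open>f(z) \<mapsto> f(-z)\<close>.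

  Conversely, testing \<open>\<lambda>\<close> on \<open>z\<^sub>i\<^sup>k (1 \<plusminus> z\<^sub>i) h\<close> with
  \<open>h = \<Prod> (1 + z\<^sub>j)\<^sup>N\<close> over \<open>j \<noteq> i\<close>, and writing
  \<open>P\<^sub>k\<close> for the part of the image of \<open>z\<^sub>i\<^sup>k h\<close> free of \<open>z\<^sub>i\<close>, gives
  \<open>P\<^sub>k \<plusminus> z\<^sub>i P\<^sub>k\<^sub>+\<^sub>1 \<noteq> 0\<close>, so \<open>P\<^sub>k / P\<^sub>k\<^sub>+\<^sub>1\<close> is
  real-valued and holomorphic, therefore constant: consecutive slices of \<open>\<lambda>\<close> are
  proportional. Since no zero slice lies between nonzero ones, \<open>\<lambda>\<close> has rank one in
  every direction and factors. The signs come from the stable polynomials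
  \<open>z\<^sup>\<alpha> (1 - z\<^sub>i z\<^sub>j)\<close>.
\<close>

section \<open>Polynomials on products of half-planes\<close>

definition uhp :: "complex ^ 'n::finite \<Rightarrow> bool" where
  "uhp z \<longleftrightarrow> (\<forall>j. Im (z $ j) > 0)"

definition vmonom :: "complex ^ 'n::finite \<Rightarrow> nat ^ 'n \<Rightarrow> complex" where
  "vmonom z \<alpha> = (\<Prod>j\<in>UNIV. (z $ j) ^ (\<alpha> $ j))"

text \<open>The index set stays fixed while coefficients are multiplied, perturbed or passed to a
  limit; zero coefficients are allowed, so \<open>K\<close> may be larger than the support.\<close>

definition mpoly_sum :: "(nat ^ 'n::finite) set \<Rightarrow> (nat ^ 'n \<Rightarrow> complex) \<Rightarrow> complex ^ 'n \<Rightarrow> complex" where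
  "mpoly_sum K a z = (\<Sum>\<alpha>\<in>K. a \<alpha> * vmonom z \<alpha>)"

definition vec_upd :: "'a ^ 'n::finite \<Rightarrow> 'n \<Rightarrow> 'a \<Rightarrow> 'a ^ 'n" where
  "vec_upd v i x = (\<chi> j. if j = i then x else v $ j)"

lemma vec_upd_nth [simp]: "vec_upd v i x $ j = (if j = i then x else v $ j)"
  by (simp add: vec_upd_def)

lemma vec_upd_same [simp]: "vec_upd v i (v $ i) = v"
  by (simp add: vec_eq_iff)

lemma vec_upd_upd [simp]: "vec_upd (vec_upd v i x) i y = vec_upd v i y"
  by (simp add: vec_eq_iff)

lemma uhp_vec_upd: "uhp z \<Longrightarrow> Im x > 0 \<Longrightarrow> uhp (vec_upd z i x)"
  by (simp add: uhp_def)

lemma vmonom_vec_upd_index: "vmonom z (vec_upd \<alpha> i k) = (z $ i) ^ k * vmonom z (vec_upd \<alpha> i 0)"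
proof -
  have "vmonom z (vec_upd \<alpha> i m) = (z $ i) ^ m * (\<Prod>j\<in>UNIV - {i}. (z $ j) ^ (\<alpha> $ j))" for m
    unfolding vmonom_def by (subst prod.remove[of _ i]) auto
  from this[of k] this[of 0] show ?thesis by simp
qed

lemma vmonom_vec_upd_0: "\<alpha> $ i = 0 \<Longrightarrow> vmonom (vec_upd z i x) \<alpha> = vmonom z \<alpha>"
  unfolding vmonom_def by (intro prod.cong) auto

lemma vmonom_vec_upd:
  "vmonom (vec_upd z i x) \<alpha> = x ^ (\<alpha> $ i) * vmonom z (vec_upd \<alpha> i 0)"
  using vmonom_vec_upd_index[of "vec_upd z i x" \<alpha> i "\<alpha> $ i"] vmonom_vec_upd_0[of "vec_upd \<alpha> i 0" i z x]
  by simp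

lemma vmonom_add: "vmonom z (\<alpha> + \<beta>) = vmonom z \<alpha> * vmonom z \<beta>"
  by (simp add: vmonom_def power_add prod.distrib)

lemma vmonom_axis: "vmonom z (axis i k) = (z $ i) ^ k"
proof -
  have "vmonom z (axis i k) = (\<Prod>j\<in>UNIV. if j = i then (z $ i) ^ k else 1)"
    unfolding vmonom_def by (intro prod.cong) (auto simp: axis_def)
  then show ?thesis by simp
qed

lemma vmonom_nonzero: "uhp z \<Longrightarrow> vmonom z \<alpha> \<noteq> 0"
proof -
  assume "uhp z"
  then have "z $ j \<noteq> 0" for j by (metis uhp_def less_irrefl zero_complex.sel(2))
  then show ?thesis by (simp add: vmonom_def)
qed

lemma mpoly_sum_zero: "(\<And>\<alpha>. \<alpha> \<in> K \<Longrightarrow> a \<alpha> = 0) \<Longrightarrow> mpoly_sum K a z = 0"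
  by (simp add: mpoly_sum_def)

section \<open>Uniqueness of coefficients from values on upper half-planes\<close>

lemma infinite_upper_half_plane: "infinite {x::complex. Im x > 0}"
proof
  assume "finite {x::complex. Im x > 0}"
  then have "finite ((\<lambda>t. Complex 0 t) ` {0<..})"
    by (rule rev_finite_subset) auto
  then have "finite {0::real<..}"
    by (rule finite_imageD) (auto simp: inj_on_def)
  then show False using infinite_Ioi by blast
qed

text \<open>Induction over the variables. With the other coordinates fixed, the sum is a polynomial
  in \<open>z $ i\<close> with infinitely many zeros, so its coefficients vanish; each of them is a
  sum of the same kind over a smaller index set, which is why \<open>K\<close> is arbitrary in the
  induction.\<close>

lemma vanishing_partial_monomial_sum:
  fixes a :: "nat ^ 'n::finite \<Rightarrow> complex"
  assumes "finite J" "finite K"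
    and "\<And>z. uhp z \<Longrightarrow> (\<Sum>\<alpha>\<in>K. a \<alpha> * (\<Prod>j\<in>J. (z $ j) ^ (\<alpha> $ j))) = 0"
  shows "(\<Sum>\<alpha>\<in>{\<alpha>\<in>K. \<forall>j\<in>J. \<alpha> $ j = \<beta> $ j}. a \<alpha>) = 0"
  using assms
proof (induction J arbitrary: K)
  case empty
  show ?case using empty.prems(2)[of "\<chi> j. \<i>"] by (simp add: uhp_def)
next
  case (insert i J)
  have "(\<Sum>\<alpha>\<in>{\<alpha>\<in>K. \<alpha> $ i = k}. a \<alpha> * (\<Prod>j\<in>J. (z $ j) ^ (\<alpha> $ j))) = 0" if z: "uhp z" for z k
  proof -
    define p where "p = (\<Sum>\<alpha>\<in>K. monom (a \<alpha> * (\<Prod>j\<in>J. (z $ j) ^ (\<alpha> $ j))) (\<alpha> $ i))"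
    have "poly p x = 0" if x: "Im x > 0" for x
    proof -
      have "poly p x = (\<Sum>\<alpha>\<in>K. a \<alpha> * (\<Prod>j\<in>insert i J. (vec_upd z i x $ j) ^ (\<alpha> $ j)))"
        unfolding p_def poly_sum poly_monom
      proof (rule sum.cong, simp)
        fix \<alpha>
        have "(\<Prod>j\<in>J. (vec_upd z i x $ j) ^ (\<alpha> $ j)) = (\<Prod>j\<in>J. (z $ j) ^ (\<alpha> $ j))"
          using insert.hyps by (intro prod.cong) auto
        then show "a \<alpha> * (\<Prod>j\<in>J. z $ j ^ \<alpha> $ j) * x ^ \<alpha> $ i =
          a \<alpha> * (\<Prod>j\<in>insert i J. vec_upd z i x $ j ^ \<alpha> $ j)"
          using insert.hyps by simp
      qed
      then show ?thesis using insert.prems(2) uhp_vec_upd[OF z x] by metis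
    qed
    then have "{x. Im x > 0} \<subseteq> {x. poly p x = 0}" by auto
    then have "p = 0"
      using infinite_upper_half_plane poly_roots_finite[of p] finite_subset by blast
    then have "coeff p k = 0" by simp
    moreover have "coeff p k = (\<Sum>\<alpha>\<in>{\<alpha>\<in>K. \<alpha> $ i = k}. a \<alpha> * (\<Prod>j\<in>J. (z $ j) ^ (\<alpha> $ j)))"
      unfolding p_def coeff_sum using insert.prems(1)
      by (intro sum.mono_neutral_cong_right) (auto simp: coeff_monom)
    ultimately show ?thesis by simp
  qed
  from insert.IH[OF _ this, of "\<beta> $ i"] insert.prems(1)
  have "(\<Sum>\<alpha>\<in>{\<alpha> \<in> {\<alpha> \<in> K. \<alpha> $ i = \<beta> $ i}. \<forall>j\<in>J. \<alpha> $ j = \<beta> $ j}. a \<alpha>) = 0"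
    by simp
  moreover have "{\<alpha> \<in> {\<alpha> \<in> K. \<alpha> $ i = \<beta> $ i}. \<forall>j\<in>J. \<alpha> $ j = \<beta> $ j} =
      {\<alpha>\<in>K. \<forall>j\<in>insert i J. \<alpha> $ j = \<beta> $ j}"
    by auto
  ultimately show ?case by simp
qed

lemma mpoly_sum_eq_0D:
  assumes "finite K" "\<And>z. uhp z \<Longrightarrow> mpoly_sum K a z = 0" "\<beta> \<in> K"
  shows "a \<beta> = 0"
proof -
  have "{\<alpha>\<in>K. \<forall>j\<in>UNIV. \<alpha> $ j = \<beta> $ j} = {\<beta>}"
    using assms(3) by (auto simp: vec_eq_iff)
  moreover have "sum a {\<alpha>\<in>K. \<forall>j\<in>UNIV. \<alpha> $ j = \<beta> $ j} = 0"
    by (rule vanishing_partial_monomial_sum)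
      (use assms in \<open>auto simp: mpoly_sum_def vmonom_def\<close>)
  ultimately show ?thesis by simp
qed

section \<open>Stability and multiplier sequences in terms of finite coefficient families\<close>

lemma real_stable_iff:
  fixes f :: "'n::finite real_mpoly"
  assumes "finite K" "Poly_Mapping.keys f \<subseteq> K"
  shows "real_stable f \<longleftrightarrow> (\<forall>z. uhp z \<longrightarrow> mpoly_sum K (\<lambda>\<alpha>. of_real (Poly_Mapping.lookup f \<alpha>)) z \<noteq> 0)"
proof -
  have "eval_mpoly f z = mpoly_sum K (\<lambda>\<alpha>. of_real (Poly_Mapping.lookup f \<alpha>)) z" for z
    unfolding eval_mpoly_def mpoly_sum_def vmonom_def using assms
    by (intro sum.mono_neutral_left) (auto simp: in_keys_iff)
  then show ?thesis by (simp add: real_stable_def uhp_def)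
qed

text \<open>The second alternative stands for the image being the zero polynomial.\<close>

lemma multiplier_sequence_iff:
  fixes l :: "nat ^ 'n::finite \<Rightarrow> real"
  shows "multiplier_sequence l \<longleftrightarrow>
    (\<forall>K a. finite K \<longrightarrow> (\<forall>z. uhp z \<longrightarrow> mpoly_sum K (\<lambda>\<alpha>. of_real (a \<alpha>)) z \<noteq> 0) \<longrightarrow>
       (\<forall>z. uhp z \<longrightarrow> mpoly_sum K (\<lambda>\<alpha>. of_real (l \<alpha> * a \<alpha>)) z \<noteq> 0) \<or> (\<forall>\<alpha>\<in>K. l \<alpha> * a \<alpha> = 0))"
    (is "_ \<longleftrightarrow> ?R")
proof
  assume l: "multiplier_sequence l"
  show ?R
  proof (intro allI impI)
    fix K :: "(nat ^ 'n) set" and a :: "nat ^ 'n \<Rightarrow> real"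
    assume K: "finite K" and nz: "\<forall>z. uhp z \<longrightarrow> mpoly_sum K (\<lambda>\<alpha>. of_real (a \<alpha>)) z \<noteq> 0"
    define f where "f = (\<Sum>\<alpha>\<in>K. Poly_Mapping.single \<alpha> (a \<alpha>))"
    have f: "Poly_Mapping.lookup f \<alpha> = (if \<alpha> \<in> K then a \<alpha> else 0)" for \<alpha>
      using K by (auto simp: f_def lookup_sum lookup_single when_def)
    then have keys: "Poly_Mapping.keys f \<subseteq> K" "Poly_Mapping.keys (diag_op l f) \<subseteq> K"
      by (auto simp: in_keys_iff split: if_splits)
    have "mpoly_sum K (\<lambda>\<alpha>. of_real (Poly_Mapping.lookup f \<alpha>)) z = mpoly_sum K (\<lambda>\<alpha>. of_real (a \<alpha>)) z"
         "mpoly_sum K (\<lambda>\<alpha>. of_real (Poly_Mapping.lookup (diag_op l f) \<alpha>)) z =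
          mpoly_sum K (\<lambda>\<alpha>. of_real (l \<alpha> * a \<alpha>)) z" for z
      by (auto simp: mpoly_sum_def f)
    note eqs = this
    have "real_stable f"
      unfolding real_stable_iff[OF K keys(1)] eqs(1) by (rule nz)
    then have "real_stable (diag_op l f) \<or> diag_op l f = 0"
      using l by (auto simp: multiplier_sequence_def)
    then show "(\<forall>z. uhp z \<longrightarrow> mpoly_sum K (\<lambda>\<alpha>. of_real (l \<alpha> * a \<alpha>)) z \<noteq> 0) \<or> (\<forall>\<alpha>\<in>K. l \<alpha> * a \<alpha> = 0)"
    proof
      assume "real_stable (diag_op l f)"
      then show ?thesis unfolding real_stable_iff[OF K keys(2)] eqs(2) by (rule disjI1)
    next
      assume "diag_op l f = 0"
      then have "Poly_Mapping.lookup (diag_op l f) \<alpha> = 0" for \<alpha> by simp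
      then have "l \<alpha> * a \<alpha> = 0" if "\<alpha> \<in> K" for \<alpha>
        using that by (metis f lookup_diag_op)
      then show ?thesis by blast
    qed
  qed
next
  assume R: ?R
  show "multiplier_sequence l"
    unfolding multiplier_sequence_def
  proof (intro subsetI, elim imageE, simp)
    fix f :: "'n real_mpoly"
    let ?K = "Poly_Mapping.keys f"
    assume "real_stable f"
    then have "\<forall>z. uhp z \<longrightarrow> mpoly_sum ?K (\<lambda>\<alpha>. of_real (Poly_Mapping.lookup f \<alpha>)) z \<noteq> 0"
      by (rule real_stable_iff[THEN iffD1, OF finite_keys order.refl])
    moreover have keys: "Poly_Mapping.keys (diag_op l f) \<subseteq> ?K"
      by (auto simp: in_keys_iff)
    ultimately consider
      "\<forall>z. uhp z \<longrightarrow> mpoly_sum ?K (\<lambda>\<alpha>. of_real (l \<alpha> * Poly_Mapping.lookup f \<alpha>)) z \<noteq> 0" |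
      "\<forall>\<alpha>\<in>?K. l \<alpha> * Poly_Mapping.lookup f \<alpha> = 0"
      using R[rule_format, OF finite_keys[of f], of "Poly_Mapping.lookup f"] by blast
    then show "diag_op l f = 0 \<or> real_stable (diag_op l f)"
    proof cases
      case 1
      then have "real_stable (diag_op l f)"
        unfolding real_stable_iff[OF finite_keys keys] lookup_diag_op .
      then show ?thesis ..
    next
      case 2
      then have "diag_op l f = 0"
        by (intro poly_mapping_eqI) (auto simp: in_keys_iff)
      then show ?thesis ..
    qed
  qed
qed

lemma multiplier_sequenceD:
  assumes "multiplier_sequence l" "finite K"
    and "\<And>z. uhp z \<Longrightarrow> mpoly_sum K (\<lambda>\<alpha>. of_real (a \<alpha>)) z \<noteq> 0"
  shows "(\<forall>z. uhp z \<longrightarrow> mpoly_sum K (\<lambda>\<alpha>. of_real (l \<alpha> * a \<alpha>)) z \<noteq> 0) \<or> (\<forall>\<alpha>\<in>K. l \<alpha> * a \<alpha> = 0)"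
  by (rule assms(1)[unfolded multiplier_sequence_iff, rule_format]) (use assms(2,3) in auto)

section \<open>Polar derivatives and the Grace--Walsh--Szego theorem\<close>

text \<open>The values \<open>1 / (x - r)\<close> with \<open>Im r \<le> 0\<close> fill a disc; by convexity it contains their mean,
  which is \<open>p' / (d p)\<close> at \<open>x\<close>.\<close>

lemma logarithmic_derivative_disc:
  fixes A :: "complex multiset"
  assumes "Im x > 0" "\<forall>r\<in>#A. Im r \<le> 0"
  defines "w \<equiv> (\<Sum>r\<in>#A. 1 / (x - r))"
  shows "poly (pderiv (\<Prod>r\<in>#A. [:-r, 1:])) x = w * poly (\<Prod>r\<in>#A. [:-r, 1:]) x"
    and "Im x * (cmod w)\<^sup>2 + real (size A) * Im w \<le> 0"
  unfolding w_def using assms(2)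
proof (induction A)
  case empty
  { case 1 then show ?case by simp next case 2 then show ?case by simp }
next
  case (add r A)
  let ?w = "\<Sum>r\<in>#A. 1 / (x - r)"
  {
    case 1
    then have "x - r \<noteq> 0" using assms(1) by auto
    define P where "P = (\<Prod>r\<in>#A. [:-r, 1:])"
    have IH: "poly (pderiv P) x = ?w * poly P x"
      using add.IH(1) 1 by (simp add: P_def)
    have "poly (pderiv ([:-r, 1:] * P)) x = (x - r) * (?w * poly P x) + poly P x"
      by (simp only: pderiv_mult poly_add poly_mult IH) (simp add: pderiv_pCons)
    also have "\<dots> = (1 / (x - r) + ?w) * ((x - r) * poly P x)"
      using \<open>x - r \<noteq> 0\<close> by (simp add: field_simps)
    also have "(x - r) * poly P x = poly ([:-r, 1:] * P) x"
      by (simp add: algebra_simps)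
    finally show ?case by (simp only: P_def image_mset_add_mset prod_mset.add_mset sum_mset.add_mset)
  next
    case 2
    have ne: "x - r \<noteq> 0" using 2 assms(1) by auto
    define v where "v = 1 / (x - r)"
    \<comment> \<open>The bound for a single zero: the imaginary part of 1 / (x - r) is -(Im x - Im
      r) times its squared modulus, and Im r \<le> 0.\<close>
    have v: "Im x * (cmod v)\<^sup>2 + Im v \<le> 0"
    proof -
      have "Im v = - (Im x - Im r) * (cmod v)\<^sup>2"
        using ne by (simp add: v_def Im_divide norm_divide power_divide cmod_power2)
      moreover have "Im r * (cmod v)\<^sup>2 \<le> 0"
        using 2 by (simp add: mult_nonpos_nonneg)
      ultimately show ?thesis by (simp add: algebra_simps)
    qed
    show ?case
    proof (cases "A = {#}")
      case True
      then show ?thesis using v by (simp add: v_def)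
    next
      case False
      define d where "d = real (size A)"
      have d: "d > 0" using False by (simp add: d_def nonempty_has_size)
      have IH: "Im x * (cmod ?w)\<^sup>2 + d * Im ?w \<le> 0"
        using add.IH(2) 2 by (simp add: d_def)
      \<comment> \<open>Convexity of the squared modulus for the mean of \<open>d\<close> copies of
        \<open>?w / d\<close> and one \<open>v\<close>, cleared of denominators; the defect is an
        exact square.\<close>
      have conv: "d * (cmod (v + ?w))\<^sup>2 \<le> (d + 1) * ((cmod ?w)\<^sup>2 + d * (cmod v)\<^sup>2)"
      proof -
        have "(d + 1) * ((cmod ?w)\<^sup>2 + d * (cmod v)\<^sup>2) - d * (cmod (v + ?w))\<^sup>2 = (cmod (?w - of_real d * v))\<^sup>2"
          by (simp only: cmod_power2) (simp add: power2_eq_square algebra_simps)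
        then show ?thesis by (smt (verit) zero_le_power2)
      qed
      have "d * (Im x * (cmod (v + ?w))\<^sup>2 + (d + 1) * Im (v + ?w)) \<le>
          Im x * ((d + 1) * ((cmod ?w)\<^sup>2 + d * (cmod v)\<^sup>2)) + d * (d + 1) * Im (v + ?w)"
        using mult_left_mono[OF conv, of "Im x"] assms(1) by (simp add: algebra_simps)
      also have "\<dots> = (d + 1) * ((Im x * (cmod ?w)\<^sup>2 + d * Im ?w) + d * (Im x * (cmod v)\<^sup>2 + Im v))"
        by (simp add: algebra_simps)
      also have "\<dots> \<le> 0"
        using IH v d by (smt (verit) mult_nonneg_nonpos)
      finally show ?thesis
        using d False by (simp add: d_def v_def mult_le_0_iff add.commute)
    qed
  }
qed

text \<open>Laguerre's theorem for the upper half-plane. If the expression vanished, the logarithmic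
  derivative at \<open>x\<close> would be M / (x - z), and the disc inequality would read Im x (M -
  degree p) + degree p Im z \<le> 0, which is impossible for M > 0. A degree below \<open>M\<close>
  amounts to zeros at infinity.\<close>

lemma polar_derivative_nonzero:
  fixes p :: "complex poly"
  assumes nz: "\<And>x. Im x > 0 \<Longrightarrow> poly p x \<noteq> 0" and deg: "degree p \<le> M" "M > 0"
    and z: "Im z > 0" and x: "Im x > 0"
  shows "of_nat M * poly p x + (z - x) * poly (pderiv p) x \<noteq> 0"
proof
  assume eq: "of_nat M * poly p x + (z - x) * poly (pderiv p) x = 0"
  have "p \<noteq> 0" using nz[OF z] by auto
  then obtain A where A: "size A = degree p" "p = smult (lead_coeff p) (\<Prod>r\<in>#A. [:-r, 1:])"
    using alg_closed_imp_factorization by blast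
  have "\<forall>r\<in>#A. Im r \<le> 0"
  proof
    fix r assume "r \<in># A"
    then have "poly p r = 0"
      by (subst A(2)) (auto simp: poly_prod_mset image_iff)
    then show "Im r \<le> 0" using nz[of r] by force
  qed
  note log = logarithmic_derivative_disc[OF x this]
  define w where "w = (\<Sum>r\<in>#A. 1 / (x - r))"
  have dp: "poly (pderiv p) x = w * poly p x"
    by (subst (1 2) A(2)) (simp add: pderiv_smult log(1) w_def)
  have "(of_nat M + (z - x) * w) * poly p x = 0"
    using eq unfolding dp by (simp add: algebra_simps)
  then have "of_nat M + (z - x) * w = 0" using nz[OF x] by simp
  then have *: "of_nat M = (x - z) * w"
    by (simp add: algebra_simps add_eq_0_iff)
  then have xz: "x - z \<noteq> 0" using deg by auto
  define q where "q = (cmod (x - z))\<^sup>2"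
  have q: "q > 0" using xz by (simp add: q_def)
  have w: "w = of_nat M / (x - z)" using * xz by (simp add: field_simps)
  have wc: "(cmod w)\<^sup>2 = (real M)\<^sup>2 / q"
    by (simp add: w norm_divide power_divide q_def)
  have wi: "Im w = - real M * (Im x - Im z) / q"
    by (simp add: w Im_divide q_def cmod_power2)
  have "Im x * ((real M)\<^sup>2 / q) + real (degree p) * (- real M * (Im x - Im z) / q) \<le> 0"
    using log(2) A(1) wc wi by (simp add: w_def)
  then have "(Im x * (real M)\<^sup>2 + real (degree p) * (- real M * (Im x - Im z))) / q \<le> 0"
    by (simp add: add_divide_distrib diff_divide_distrib)
  then have "real M * (Im x * real M - real (degree p) * (Im x - Im z)) \<le> 0"
    using q by (simp add: divide_le_0_iff power2_eq_square algebra_simps)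
  then have "Im x * real M - real (degree p) * (Im x - Im z) \<le> 0"
    using deg(2) by (simp add: mult_le_0_iff)
  then have "Im x * (real M - real (degree p)) + real (degree p) * Im z \<le> 0"
    by (simp add: algebra_simps)
  moreover have "Im x * (real M - real (degree p)) \<ge> 0" "real (degree p) * Im z \<ge> 0"
    using deg x z by auto
  ultimately have "Im x * (real M - real (degree p)) = 0" "real (degree p) * Im z = 0"
    by linarith+
  then show False using x z deg by auto
qed

text \<open>A form of the Grace--Walsh--Szego theorem: the sum is the symmetric multiaffine polarisation
  of \<open>p\<close> at the points \<open>w / u\<close>, up to the factor \<open>\<Prod> u\<close>. Each factor is
  absorbed by one polar derivative.\<close>

lemma grace_walsh_szego:
  fixes p :: "complex poly" and F :: "(complex \<times> complex) multiset"
  assumes "\<And>x. Im x > 0 \<Longrightarrow> poly p x \<noteq> 0" "degree p \<le> size F"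
    and "\<forall>(u, w)\<in>#F. u \<noteq> 0 \<and> Im (w / u) > 0"
  shows "(\<Sum>k\<le>size F. coeff p k * coeff (\<Prod>(u, w)\<in>#F. [:u, w:]) k / of_nat (size F choose k)) \<noteq> 0"
  using assms
proof (induction F arbitrary: p)
  case empty
  then obtain c where "p = [:c:]" by (auto elim!: degree_eq_zeroE)
  then show ?case using empty.prems(1)[of \<i>] by simp
next
  case (add uw F)
  obtain u w where uw: "uw = (u, w)" by force
  define N where "N = size F"
  define B where "B = (\<Prod>(u, w)\<in>#F. [:u, w:])"
  have u: "u \<noteq> 0" "Im (w / u) > 0" using add.prems(3) by (auto simp: uw)
  \<comment> \<open>Up to the factor \<open>u\<close>, this is the polar derivative of
    \<open>p\<close>, taken with formal degree \<open>Suc N\<close>, at the pole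
    \<open>w / u\<close>; its coefficient of degree \<open>Suc N\<close> cancels.\<close>
  define q where "q = smult (u * of_nat (Suc N)) p + [:w, -u:] * pderiv p"
  have cq: "coeff q k = u * (of_nat (Suc N) - of_nat k) * coeff p k + w * of_nat (Suc k) * coeff p (Suc k)" for k
    by (cases k) (simp_all add: q_def coeff_pderiv algebra_simps)
  have deg_p: "degree p \<le> Suc N" using add.prems(2) by (simp add: N_def)
  have "degree q \<le> N"
  proof (intro degree_le allI impI)
    fix k assume "k > N"
    then have "k = Suc N \<or> coeff p k = 0" "coeff p (Suc k) = 0"
      using deg_p by (auto intro: coeff_eq_0)
    then show "coeff q k = 0" by (auto simp: cq)
  qed
  moreover have "poly q x \<noteq> 0" if "Im x > 0" for x
  proof -
    have "poly q x = u * (of_nat (Suc N) * poly p x + (w / u - x) * poly (pderiv p) x)"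
      using u by (simp add: q_def field_simps)
    then show ?thesis
      using polar_derivative_nonzero[OF add.prems(1) deg_p _ u(2) that] u by simp
  qed
  ultimately have IH: "(\<Sum>k\<le>N. coeff q k * coeff B k / of_nat (N choose k)) \<noteq> 0"
    using add.IH[of q] add.prems(3) by (simp add: N_def B_def)
  have B0: "coeff B k = 0" if "k > N" for k
  proof -
    have "degree B \<le> N"
      unfolding B_def N_def
    proof (induction F)
      case (add x F)
      have "degree (case x of (u, w) \<Rightarrow> [:u, w:]) \<le> 1" by (auto split: prod.split)
      then show ?case
        using add degree_mult_le[of "case x of (u, w) \<Rightarrow> [:u, w:]" "\<Prod>(u, w)\<in>#F. [:u, w:]"]
        by (simp only: image_mset_add_mset prod_mset.add_mset size_add_mset)
    qed simp
    then show ?thesis using that by (intro coeff_eq_0) simp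
  qed
  \<comment> \<open>The two absorption identities trade the binomial weights of \<open>N\<close> for
    those of \<open>Suc N\<close> with the common factor \<open>Suc N\<close>, so that pairing
    \<open>q\<close> with \<open>B\<close> becomes pairing \<open>p\<close> with
    \<open>[:u, w:] * B\<close>.\<close>
  have bin1: "of_nat (Suc N - k) / of_nat (N choose k) = of_nat (Suc N) / (of_nat (Suc N choose k) :: complex)"
    if "k \<le> N" for k
  proof -
    have "(Suc N - k) * (Suc N choose k) = Suc N * (N choose k)"
      using binomial_absorb_comp[of "Suc N" k] by simp
    then have "of_nat (Suc N - k) * of_nat (Suc N choose k) = (of_nat (Suc N) * of_nat (N choose k) :: complex)"
      by (metis of_nat_mult)
    moreover have "of_nat (Suc N choose k) \<noteq> (0::complex)" "of_nat (N choose k) \<noteq> (0::complex)"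
      using that by (simp_all del: of_nat_Suc binomial_Suc_Suc)
    ultimately show ?thesis by (simp add: field_simps del: of_nat_Suc binomial_Suc_Suc)
  qed
  have bin2: "of_nat (Suc k) / of_nat (N choose k) = of_nat (Suc N) / (of_nat (Suc N choose Suc k) :: complex)"
    if "k \<le> N" for k
  proof -
    have "Suc k * (Suc N choose Suc k) = Suc N * (N choose k)"
      using Suc_times_binomial_eq[of N k] by (simp only: mult.commute)
    then have "of_nat (Suc k) * of_nat (Suc N choose Suc k) = (of_nat (Suc N) * of_nat (N choose k) :: complex)"
      by (metis of_nat_mult)
    moreover have "of_nat (Suc N choose Suc k) \<noteq> (0::complex)" "of_nat (N choose k) \<noteq> (0::complex)"
      using that by (simp_all del: of_nat_Suc binomial_Suc_Suc)
    ultimately show ?thesis by (simp add: field_simps del: of_nat_Suc binomial_Suc_Suc)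
  qed
  have shift: "coeff (pCons 0 (smult w B)) k = w * coeff (pCons 0 B) k" for k
    by (cases k) simp_all
  let ?c = "\<lambda>k. coeff p k / of_nat (Suc N choose k)"
  have "(\<Sum>k\<le>N. coeff q k * coeff B k / of_nat (N choose k)) =
      (\<Sum>k\<le>N. of_nat (Suc N) * (u * (?c k * coeff B k) + w * (?c (Suc k) * coeff B k)))"
  proof (intro sum.cong refl)
    fix k assume "k \<in> {..N}"
    then have k: "k \<le> N" by simp
    have "coeff q k * coeff B k / of_nat (N choose k) =
        u * coeff p k * coeff B k * (of_nat (Suc N - k) / of_nat (N choose k)) +
        w * coeff p (Suc k) * coeff B k * (of_nat (Suc k) / of_nat (N choose k))"
    proof -
      have "of_nat (Suc N) - of_nat k = (of_nat (Suc N - k) :: complex)"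
        using k by (simp only: of_nat_diff le_SucI)
      then show ?thesis
        unfolding cq by (simp only:) (simp add: add_divide_distrib ring_distribs mult_ac
          del: binomial_Suc_Suc of_nat_Suc)
    qed
    then show "coeff q k * coeff B k / of_nat (N choose k) =
        of_nat (Suc N) * (u * (?c k * coeff B k) + w * (?c (Suc k) * coeff B k))"
      unfolding bin1[OF k] bin2[OF k] by (simp add: algebra_simps del: binomial_Suc_Suc of_nat_Suc)
  qed
  also have "\<dots> = of_nat (Suc N) * (u * (\<Sum>k\<le>N. ?c k * coeff B k) + w * (\<Sum>k\<le>N. ?c (Suc k) * coeff B k))"
    by (simp add: sum_distrib_left sum.distrib ring_distribs del: binomial_Suc_Suc of_nat_Suc)
  also have "(\<Sum>k\<le>N. ?c k * coeff B k) = (\<Sum>k\<le>Suc N. ?c k * coeff B k)"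
    by (simp add: B0)
  also have "(\<Sum>k\<le>N. ?c (Suc k) * coeff B k) = (\<Sum>k\<le>Suc N. ?c k * coeff (pCons 0 B) k)"
    by (subst sum.atMost_Suc_shift) (simp del: binomial_Suc_Suc)
  also have "of_nat (Suc N) * (u * (\<Sum>k\<le>Suc N. ?c k * coeff B k) + w * (\<Sum>k\<le>Suc N. ?c k * coeff (pCons 0 B) k)) =
     of_nat (Suc N) * (\<Sum>k\<le>Suc N. coeff p k * coeff ([:u, w:] * B) k / of_nat (Suc N choose k))"
    using shift by (simp add: sum_distrib_left ring_distribs mult_ac add_divide_distrib flip: sum.distrib
      del: binomial_Suc_Suc of_nat_Suc sum.atMost_Suc)
  finally show ?case
    using IH by (simp add: uw N_def B_def del: binomial_Suc_Suc of_nat_Suc sum.atMost_Suc)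
qed

section \<open>Products of univariate multiplier sequences\<close>

lemma coeff_prod_linear_scale:
  fixes F :: "(real \<times> real) multiset" and c :: complex
  shows "coeff (\<Prod>(u, v)\<in>#F. [:of_real u, of_real v * c:]) k =
    of_real (coeff (\<Prod>(u, v)\<in>#F. [:u, v:]) k) * c ^ k"
proof (induction F arbitrary: k)
  case empty
  show ?case by (cases k) auto
next
  case (add x F)
  obtain u v where x: "x = (u, v)" by force
  show ?case by (cases k) (simp_all add: x add.IH, simp_all add: algebra_simps)
qed

text \<open>With the other coordinates frozen, the sum is a polynomial in the variable of index
  \<open>i\<close> without zeros in the upper half-plane. Grace--Walsh--Szego is applied at the
  points \<open>(v / u) * z $ i\<close>, which stay there because u, v > 0; the pairing it yields is
  the sum with altered coefficients.\<close>

lemma mpoly_sum_factor_multiplier_nonzero: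
  fixes F :: "(real \<times> real) multiset"
  assumes nz: "\<And>z. uhp z \<Longrightarrow> mpoly_sum K a z \<noteq> 0"
    and deg: "\<And>\<alpha>. \<alpha> \<in> K \<Longrightarrow> \<alpha> $ i \<le> size F" and F: "\<forall>(u, v)\<in>#F. u > 0 \<and> v > 0" and z: "uhp z"
  shows "mpoly_sum K (\<lambda>\<alpha>. of_real (coeff (\<Prod>(u, v)\<in>#F. [:u, v:]) (\<alpha> $ i) / (size F choose \<alpha> $ i)) * a \<alpha>) z \<noteq> 0"
proof -
  define p where "p = (\<Sum>\<alpha>\<in>K. monom (a \<alpha> * vmonom z (vec_upd \<alpha> i 0)) (\<alpha> $ i))"
  have p: "poly p x = mpoly_sum K a (vec_upd z i x)" for x
    unfolding p_def poly_sum poly_monom mpoly_sum_def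
    by (intro sum.cong refl) (subst vmonom_vec_upd, simp)
  define G where "G = image_mset (\<lambda>(u, v). (of_real u :: complex, of_real v * z $ i)) F"
  let ?b = "\<lambda>k. of_real (coeff (\<Prod>(u, v)\<in>#F. [:u, v:]) k) * (z $ i) ^ k / of_nat (size F choose k)"
  have "(\<Sum>k\<le>size G. coeff p k * coeff (\<Prod>(u, w)\<in>#G. [:u, w:]) k / of_nat (size G choose k)) \<noteq> 0"
  proof (rule grace_walsh_szego)
    show "poly p x \<noteq> 0" if "Im x > 0" for x
      unfolding p using nz uhp_vec_upd[OF z that] by blast
    show "degree p \<le> size G"
      unfolding p_def G_def size_image_mset
      by (intro degree_le allI impI)
        (auto simp: coeff_sum coeff_monom dest: deg intro!: sum.neutral)
    show "\<forall>(u, w)\<in>#G. u \<noteq> 0 \<and> Im (w / u) > 0"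
      using F z by (auto simp: G_def uhp_def)
  qed
  also have "(\<Prod>(u, w)\<in>#G. [:u, w:]) = (\<Prod>(u, v)\<in>#F. [:of_real u, of_real v * z $ i:])"
    by (simp add: G_def image_mset.compositionality comp_def case_prod_unfold)
  also have "(\<Sum>k\<le>size G. coeff p k * coeff \<dots> k / of_nat (size G choose k)) = (\<Sum>k\<le>size F. coeff p k * ?b k)"
    by (simp add: coeff_prod_linear_scale G_def)
  also have "\<dots> = (\<Sum>\<alpha>\<in>K. \<Sum>k\<le>size F. (if \<alpha> $ i = k then a \<alpha> * vmonom z (vec_upd \<alpha> i 0) * ?b k else 0))"
    unfolding p_def coeff_sum coeff_monom sum_distrib_right
    by (subst sum.swap) (intro sum.cong refl, auto)
  also have "\<dots> = (\<Sum>\<alpha>\<in>K. a \<alpha> * vmonom z (vec_upd \<alpha> i 0) * ?b (\<alpha> $ i))"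
    using deg by (intro sum.cong refl) simp
  also have "\<dots> = mpoly_sum K (\<lambda>\<alpha>. of_real (coeff (\<Prod>(u, v)\<in>#F. [:u, v:]) (\<alpha> $ i) / (size F choose \<alpha> $ i)) * a \<alpha>) z"
    unfolding mpoly_sum_def
  proof (intro sum.cong refl)
    fix \<alpha>
    have "vmonom z \<alpha> = (z $ i) ^ (\<alpha> $ i) * vmonom z (vec_upd \<alpha> i 0)"
      using vmonom_vec_upd_index[of z \<alpha> i "\<alpha> $ i"] by simp
    then show "a \<alpha> * vmonom z (vec_upd \<alpha> i 0) * ?b (\<alpha> $ i) =
      of_real (coeff (\<Prod>(u, v)\<in>#F. [:u, v:]) (\<alpha> $ i) / (size F choose \<alpha> $ i)) * a \<alpha> * vmonom z \<alpha>"
      by simp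
  qed
  finally show ?thesis .
qed

section \<open>Univariate multiplier sequences and their action on (1 + x)^N\<close>

lemma vmonom_1: "vmonom (z :: complex ^ 1) \<alpha> = (z $ 1) ^ (\<alpha> $ 1)"
  by (simp add: vmonom_def UNIV_1)

lemma mpoly_sum_1: "mpoly_sum (vec ` {..N}) a (z :: complex ^ 1) = (\<Sum>k\<le>N. a (vec k) * (z $ 1) ^ k)"
proof -
  have "inj_on (vec :: nat \<Rightarrow> nat ^ 1) {..N}"
    by (auto simp: inj_on_def vec_eq_iff)
  then show ?thesis
    by (simp add: mpoly_sum_def sum.reindex vmonom_1)
qed

lemma univariate_multiplier_sequenceD:
  assumes m: "univariate_multiplier_sequence m"
    and nz: "\<And>x. Im x > 0 \<Longrightarrow> (\<Sum>k\<le>N. of_real (a k) * x ^ k) \<noteq> 0"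
    and k: "k \<le> N" "m k * a k \<noteq> 0" and x: "Im x > 0"
  shows "(\<Sum>k\<le>N. of_real (m k * a k) * x ^ k) \<noteq> 0"
proof -
  let ?K = "vec ` {..N} :: (nat ^ 1) set"
  have "mpoly_sum ?K (\<lambda>\<alpha>. of_real (a (\<alpha> $ 1))) z \<noteq> 0" if "uhp z" for z
  proof -
    have "Im (z $ 1) > 0" using that by (simp only: uhp_def)
    from nz[OF this] show ?thesis by (simp only: mpoly_sum_1 vec_component not_False_eq_True)
  qed
  then have "(\<forall>z. uhp z \<longrightarrow> mpoly_sum ?K (\<lambda>\<alpha>. of_real (m (\<alpha> $ 1) * a (\<alpha> $ 1))) z \<noteq> 0) \<or>
      (\<forall>\<alpha>\<in>?K. m (\<alpha> $ 1) * a (\<alpha> $ 1) = 0)"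
    by (intro multiplier_sequenceD[OF m[unfolded univariate_multiplier_sequence_def]]) (auto simp only: finite_imageI finite_atMost)
  moreover have "\<exists>\<alpha>\<in>?K. m (\<alpha> $ 1) * a (\<alpha> $ 1) \<noteq> 0"
    using k by (intro bexI[where x = "vec k"] imageI) (simp_all only: vec_component atMost_iff not_False_eq_True)
  moreover have "uhp (vec x :: complex ^ 1)"
    using x by (simp add: uhp_def)
  ultimately have "mpoly_sum ?K (\<lambda>\<alpha>. of_real (m (\<alpha> $ 1) * a (\<alpha> $ 1))) (vec x) \<noteq> 0"
    by blast
  then show ?thesis by (simp only: mpoly_sum_1 vec_component not_False_eq_True)
qed

text \<open>The image \<open>q\<close> of (1 + x)^N has only real zeros, and the constant sign of
  \<open>m\<close> rules out positive ones. The linear factors of \<open>q\<close>, padded by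
  constants, form \<open>F\<close>.\<close>

lemma univariate_multiplier_factorization:
  assumes m: "univariate_multiplier_sequence m" and sgn: "\<And>k l. m k * m l \<ge> 0"
    and k0: "k0 \<le> N" "m k0 \<noteq> 0"
  obtains c F where "size F = N" "\<forall>(u, v)\<in>#F. u \<ge> 0 \<and> v \<ge> 0"
    "\<And>k. k \<le> N \<Longrightarrow> m k = c * coeff (\<Prod>(u, v)\<in>#F. [:u, v:]) k / (N choose k)"
proof -
  define q where "q = (\<Sum>k\<le>N. monom (of_real (m k * (N choose k)) :: complex) k)"
  have poly_q: "poly q x = (\<Sum>k\<le>N. of_real (m k * (N choose k)) * x ^ k)" for x
    by (simp add: q_def poly_sum poly_monom)
  have coeff_q: "coeff q k = (if k \<le> N then of_real (m k * (N choose k)) else 0)" for k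
    by (simp add: q_def coeff_sum coeff_monom)
  have up: "poly q x \<noteq> 0" if "Im x > 0" for x
    unfolding poly_q
  proof (rule univariate_multiplier_sequenceD[OF m _ k0(1) _ that])
    show "(\<Sum>k\<le>N. of_real (real (N choose k)) * y ^ k) \<noteq> 0" if "Im y > 0" for y :: complex
    proof -
      have "(\<Sum>k\<le>N. of_real (real (N choose k)) * y ^ k) = (y + 1) ^ N"
        by (simp add: binomial_ring)
      moreover have "y + 1 \<noteq> 0"
        using that by (auto simp: complex_eq_iff)
      ultimately show ?thesis by simp
    qed
  qed (use k0 in simp)
  have "poly q (cnj x) = cnj (poly q x)" for x
    by (simp add: poly_q)
  then have low: "poly q x \<noteq> 0" if "Im x < 0" for x
    using up[of "cnj x"] that by auto
  have pos: "poly q (of_real r) \<noteq> 0" if "r > 0" for r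
  proof
    assume "poly q (of_real r) = 0"
    then have "of_real (\<Sum>k\<le>N. m k * (N choose k) * r ^ k) = (0 :: complex)"
      by (simp add: poly_q)
    then have "(\<Sum>k\<le>N. m k * (N choose k) * r ^ k) = 0"
      by (simp only: of_real_eq_0_iff)
    \<comment> \<open>Multiplying by \<open>m k0\<close> makes every term nonnegative, while the
      term of index \<open>k0\<close> is strictly positive.\<close>
    then have "(\<Sum>k\<le>N. m k0 * m k * (N choose k) * r ^ k) = 0"
      by (metis (no_types, lifting) mult.assoc mult_zero_right sum.cong sum_distrib_left)
    moreover have "\<forall>k\<in>{..N}. m k0 * m k * (N choose k) * r ^ k \<ge> 0"
      using sgn that by simp
    ultimately have "m k0 * m k0 * (N choose k0) * r ^ k0 = 0"
      using sum_nonneg_eq_0_iff[of "{..N}" "\<lambda>k. m k0 * m k * (N choose k) * r ^ k"] k0 by auto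
    then show False using k0 that by simp
  qed
  have "q \<noteq> 0" using up[of \<i>] by auto
  then obtain A c where A: "size A = degree q" "q = smult c (\<Prod>r\<in>#A. [:-r, 1:])"
    using alg_closed_imp_factorization by blast
  have roots: "Im r = 0 \<and> Re r \<le> 0" if "r \<in># A" for r
  proof -
    have 0: "poly q r = 0"
      by (subst A(2)) (use that in \<open>auto simp: poly_prod_mset image_iff\<close>)
    then have "Im r = 0" using up[of r] low[of r] by fastforce
    then have "r = of_real (Re r)" by (simp add: complex_eq_iff)
    with 0 pos[of "Re r"] \<open>Im r = 0\<close> show ?thesis by fastforce
  qed
  have "degree q \<le> N"
    by (intro degree_le) (simp add: coeff_q)
  \<comment> \<open>The pairs \<open>(1, 0)\<close>, zeros at infinity, make up for a degree below
    \<open>N\<close>.\<close>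
  define F where "F = image_mset (\<lambda>r. (- Re r, 1 :: real)) A + replicate_mset (N - size A) (1, 0)"
  have "(\<Prod>r\<in>#A. [:-r, 1:]) = (\<Prod>(u, v)\<in>#F. [:of_real u, of_real v:])"
  proof -
    have "image_mset (\<lambda>r. [:-r, 1:]) A = image_mset (\<lambda>r. [:of_real (- Re r), 1:]) A"
      using roots by (intro image_mset_cong) (auto simp: complex_eq_iff)
    then show ?thesis
      by (simp add: F_def image_mset.compositionality comp_def case_prod_unfold flip: one_pCons)
  qed
  then have qF: "q = smult (c) (\<Prod>(u, v)\<in>#F. [:of_real u, of_real v:])"
    using A(2) by simp
  have "coeff q k = c * of_real (coeff (\<Prod>(u, v)\<in>#F. [:u, v:]) k)" for k
    using arg_cong[OF qF, of "\<lambda>p. coeff p k"] coeff_prod_linear_scale[of 1 F k] by simp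
  \<comment> \<open>Apart from \<open>c\<close> everything here is real, so \<open>c\<close> may be
    replaced by its real part.\<close>
  then have "Re (coeff q k) = Re (c) * coeff (\<Prod>(u, v)\<in>#F. [:u, v:]) k" for k
    by simp
  moreover have "Re (coeff q k) = m k * (N choose k)" if "k \<le> N" for k
    using that by (simp add: coeff_q)
  ultimately have "m k = Re (c) * coeff (\<Prod>(u, v)\<in>#F. [:u, v:]) k / (N choose k)" if "k \<le> N" for k
    using that by (simp add: field_simps)
  moreover have "size F = N"
    using A(1) \<open>degree q \<le> N\<close> by (simp add: F_def)
  moreover have "\<forall>(u, v)\<in>#F. u \<ge> 0 \<and> v \<ge> 0"
    using roots by (auto simp: F_def)
  ultimately show thesis using that by blast
qed

text \<open>Each coefficient is a polynomial in the entries of the pairs. For \<open>e n > 0\<close>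
  the shift makes nonnegative pairs strictly positive, as the Grace--Walsh--Szego step
  requires.\<close>

lemma tendsto_coeff_prod_linear:
  fixes F :: "(real \<times> real) multiset"
  assumes "e \<longlonglongrightarrow> 0"
  shows "(\<lambda>n. coeff (\<Prod>(u, v)\<in>#F. [:u + e n, v + e n:]) k) \<longlonglongrightarrow> coeff (\<Prod>(u, v)\<in>#F. [:u, v:]) k"
proof (induction F arbitrary: k)
  case (add x F)
  obtain u v where x: "x = (u, v)" by force
  have "(\<lambda>n. u + e n) \<longlonglongrightarrow> u" "(\<lambda>n. v + e n) \<longlonglongrightarrow> v"
    using tendsto_add[OF tendsto_const assms] by force+
  then show ?case
    by (cases k) (auto simp: x intro!: tendsto_intros add.IH)
qed simp

section \<open>Complex lines and Hurwitz' theorem in several variables\<close>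

definition complex_line :: "complex ^ 'n \<Rightarrow> complex ^ 'n \<Rightarrow> complex \<Rightarrow> complex ^ 'n" where
  "complex_line z w t = (\<chi> j. z $ j + t * (w $ j - z $ j))"

lemma complex_line_ends [simp]: "complex_line z w 0 = z" "complex_line z w 1 = w"
  by (simp_all add: complex_line_def vec_eq_iff)

lemma open_complex_line_uhp: "open {t. uhp (complex_line z (w :: complex ^ 'n::finite) t)}"
proof -
  have "{t. uhp (complex_line z w t)} = (\<Inter>j. {t. Im (z $ j + t * (w $ j - z $ j)) > 0})"
    by (auto simp: uhp_def complex_line_def)
  moreover have "open {t. Im (z $ j + t * (w $ j - z $ j)) > 0}" for j
    by (intro open_Collect_less continuous_intros)
  ultimately show ?thesis by auto
qed

text \<open>The coordinates of the line are affine in \<open>t\<close>, so the parameters that stay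
  in the product of half-planes form a convex set, a domain for one-variable theorems.\<close>

lemma connected_complex_line_uhp: "connected {t. uhp (complex_line z (w :: complex ^ 'n::finite) t)}"
proof (rule convex_connected, rule convexI)
  fix s t :: complex and a b :: real
  assume s: "s \<in> {t. uhp (complex_line z w t)}" and t: "t \<in> {t. uhp (complex_line z w t)}"
    and ab: "a \<ge> 0" "b \<ge> 0" "a + b = 1"
  have "Im (complex_line z w (a *\<^sub>R s + b *\<^sub>R t) $ j) =
      a * Im (complex_line z w s $ j) + b * Im (complex_line z w t $ j)" for j
  proof -
    have b: "b = 1 - a" using ab by simp
    show ?thesis by (simp add: complex_line_def b algebra_simps)
  qed
  moreover have "a * Im (complex_line z w s $ j) + b * Im (complex_line z w t $ j) > 0" for j
  proof -
    have "Im (complex_line z w s $ j) > 0" "Im (complex_line z w t $ j) > 0"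
      using s t by (simp_all add: uhp_def)
    then show ?thesis
      using ab by (cases "a = 0") (auto intro: add_pos_nonneg)
  qed
  ultimately show "a *\<^sub>R s + b *\<^sub>R t \<in> {t. uhp (complex_line z w t)}"
    by (simp add: uhp_def)
qed

lemma holomorphic_vmonom_complex_line: "(\<lambda>t. vmonom (complex_line z w t) \<alpha>) holomorphic_on S"
  unfolding vmonom_def complex_line_def by (auto intro!: holomorphic_intros)

lemma holomorphic_mpoly_sum_complex_line: "(\<lambda>t. mpoly_sum K a (complex_line z w t)) holomorphic_on S"
  unfolding mpoly_sum_def by (intro holomorphic_intros holomorphic_vmonom_complex_line)

lemma uniform_limit_mpoly_sum_complex_line:
  assumes "finite K" "compact C" "\<And>\<alpha>. \<alpha> \<in> K \<Longrightarrow> (\<lambda>n::nat. a n \<alpha>) \<longlonglongrightarrow> b \<alpha>"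
  shows "uniform_limit C (\<lambda>n t. mpoly_sum K (a n) (complex_line z w t))
    (\<lambda>t. mpoly_sum K b (complex_line z w t)) sequentially"
  using assms(1,3) unfolding mpoly_sum_def
proof (induction K)
  case empty
  show ?case by (simp add: uniform_limit_const)
next
  case (insert \<alpha> K)
  have "uniform_limit C (\<lambda>n t. a n \<alpha>) (\<lambda>t. b \<alpha>) sequentially"
    using insert.prems[of \<alpha>] by (auto simp: uniform_limit_iff tendsto_iff)
  moreover have "bounded ((\<lambda>t. vmonom (complex_line z w t) \<alpha>) ` C)"
    by (intro compact_imp_bounded compact_continuous_image assms(2)
      holomorphic_on_imp_continuous_on holomorphic_vmonom_complex_line)
  moreover have "bounded ((\<lambda>t. b \<alpha>) ` C)"
    by (rule bounded_subset[of "{b \<alpha>}"]) auto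
  ultimately have "uniform_limit C (\<lambda>n t. a n \<alpha> * vmonom (complex_line z w t) \<alpha>)
      (\<lambda>t. b \<alpha> * vmonom (complex_line z w t) \<alpha>) sequentially"
    by (intro uniform_lim_mult uniform_limit_const)
  then show ?case
    using insert.hyps insert.IH insert.prems by (simp add: uniform_limit_add)
qed

text \<open>Hurwitz' theorem on the line from \<open>z\<close> to \<open>w\<close>: if the limit
  vanished at \<open>z\<close>, its restriction would be nonconstant because of \<open>w\<close>,
  and a nonconstant limit of zero-free functions has no zero.\<close>

lemma mpoly_sum_limit_nonzero:
  assumes K: "finite K" and nz: "\<And>n z. uhp z \<Longrightarrow> mpoly_sum K (a n) z \<noteq> 0"
    and lim: "\<And>\<alpha>. \<alpha> \<in> K \<Longrightarrow> (\<lambda>n::nat. a n \<alpha>) \<longlonglongrightarrow> b \<alpha>"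
    and w: "uhp w" "mpoly_sum K b w \<noteq> 0" and z: "uhp z"
  shows "mpoly_sum K b z \<noteq> 0"
proof
  assume 0: "mpoly_sum K b z = 0"
  let ?S = "{t. uhp (complex_line z w t)}"
  have "mpoly_sum K b (complex_line z w 0) \<noteq> 0"
  proof (rule Hurwitz_no_zeros[of ?S "\<lambda>n t. mpoly_sum K (a n) (complex_line z w t)"
        "\<lambda>t. mpoly_sum K b (complex_line z w t)" 0])
    show "\<not> (\<lambda>t. mpoly_sum K b (complex_line z w t)) constant_on ?S"
    proof
      assume "(\<lambda>t. mpoly_sum K b (complex_line z w t)) constant_on ?S"
      then obtain c where c: "\<And>t. t \<in> ?S \<Longrightarrow> mpoly_sum K b (complex_line z w t) = c"
        by (auto simp: constant_on_def)
      from c[of 0] c[of 1] show False using 0 w z by simp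
    qed
  qed (use z nz in \<open>auto intro!: open_complex_line_uhp connected_complex_line_uhp
      holomorphic_mpoly_sum_complex_line uniform_limit_mpoly_sum_complex_line K lim\<close>)
  then show False using 0 by simp
qed

lemma product_multiplier_sequence:
  fixes m :: "'n::finite \<Rightarrow> nat \<Rightarrow> real"
  assumes m: "\<And>i. univariate_multiplier_sequence (m i)" and sgn: "\<And>i k l. m i k * m i l \<ge> 0"
  shows "multiplier_sequence (\<lambda>\<alpha>. \<Prod>i\<in>UNIV. m i (\<alpha> $ i))"
  unfolding multiplier_sequence_iff
proof (intro allI impI)
  fix K :: "(nat ^ 'n) set" and a :: "nat ^ 'n \<Rightarrow> real"
  assume K: "finite K" and nz: "\<forall>z. uhp z \<longrightarrow> mpoly_sum K (\<lambda>\<alpha>. of_real (a \<alpha>)) z \<noteq> 0"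
  define N where "N = (\<Sum>\<alpha>\<in>K. \<Sum>i\<in>UNIV. \<alpha> $ i)"
  have N: "\<alpha> $ i \<le> N" if "\<alpha> \<in> K" for \<alpha> i
  proof -
    have "\<alpha> $ i \<le> (\<Sum>i\<in>UNIV. \<alpha> $ i)" by (rule member_le_sum) auto
    also have "\<dots> \<le> N" unfolding N_def using K that by (intro member_le_sum) auto
    finally show ?thesis .
  qed
  let ?l = "\<lambda>\<alpha> :: nat ^ 'n. \<Prod>i\<in>UNIV. m i (\<alpha> $ i)"
  \<comment> \<open>If one factor vanishes at all exponents up to \<open>N\<close>, the image is
    zero; otherwise every factor is represented by \<open>N\<close> nonnegative pairs.\<close>
  show "(\<forall>z. uhp z \<longrightarrow> mpoly_sum K (\<lambda>\<alpha>. of_real (?l \<alpha> * a \<alpha>)) z \<noteq> 0) \<or> (\<forall>\<alpha>\<in>K. ?l \<alpha> * a \<alpha> = 0)"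
  proof (cases "\<exists>i. \<forall>k\<le>N. m i k = 0")
    case True
    then show ?thesis using N by (metis UNIV_I finite mult_zero_left prod_zero_iff)
  next
    case False
    have "\<exists>F c. size F = N \<and> (\<forall>(u, v)\<in>#F. u \<ge> 0 \<and> v \<ge> 0) \<and>
        (\<forall>k\<le>N. m i k = c * coeff (\<Prod>(u, v)\<in>#F. [:u, v:]) k / (N choose k))" for i
    proof -
      obtain k0 where "k0 \<le> N" "m i k0 \<noteq> 0" using False by blast
      from univariate_multiplier_factorization[OF m sgn this] show ?thesis by metis
    qed
    then obtain F c where F: "\<And>i. size (F i) = N" "\<And>i. \<forall>(u, v)\<in>#F i. u \<ge> 0 \<and> v \<ge> 0"
      and mF: "\<And>i k. k \<le> N \<Longrightarrow> m i k = c i * coeff (\<Prod>(u, v)\<in>#F i. [:u, v:]) k / (N choose k)"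
      by metis
    have c: "c i \<noteq> 0" for i
      using False mF by fastforce
    define e where "e n = 1 / real (Suc n)" for n
    have e: "e \<longlonglongrightarrow> 0" "\<And>n. e n > 0"
      unfolding e_def using LIMSEQ_Suc[OF lim_1_over_n] by auto
    \<comment> \<open>The perturbed multipliers come from strictly positive pairs and converge to
      \<open>m i\<close> up to degree \<open>N\<close>.\<close>
    define b where "b n i k = c i * coeff (\<Prod>(u, v)\<in>#F i. [:u + e n, v + e n:]) k / (N choose k)" for n i k
    have blim: "(\<lambda>n. b n i k) \<longlonglongrightarrow> m i k" if "k \<le> N" for i k
      unfolding b_def mF[OF that] using that by (auto intro!: tendsto_intros tendsto_coeff_prod_linear e)
    \<comment> \<open>The multipliers are applied one variable at a time; \<open>J\<close> holds the
      directions already treated.\<close>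
    have partial: "mpoly_sum K (\<lambda>\<alpha>. of_real ((\<Prod>i\<in>J. b n i (\<alpha> $ i)) * a \<alpha>)) z \<noteq> 0"
      if "finite J" "uhp z" for n J and z :: "complex ^ 'n"
      using that
    proof (induction J arbitrary: z)
      case empty
      then show ?case using nz by simp
    next
      case (insert i J)
      let ?F = "image_mset (\<lambda>(u, v). (u + e n, v + e n)) (F i)"
      have size: "size ?F = N" by (simp add: F)
      let ?S = "mpoly_sum K (\<lambda>\<alpha>. of_real (coeff (\<Prod>(u, v)\<in>#?F. [:u, v:]) (\<alpha> $ i) / (size ?F choose \<alpha> $ i)) *
          of_real ((\<Prod>i\<in>J. b n i (\<alpha> $ i)) * a \<alpha>)) z"
      have "?S \<noteq> 0"
      proof (rule mpoly_sum_factor_multiplier_nonzero)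
        show "\<alpha> $ i \<le> size ?F" if "\<alpha> \<in> K" for \<alpha>
          using N[OF that] by (simp add: F)
        show "\<forall>(u, v)\<in>#?F. u > 0 \<and> v > 0"
          using F(2)[of i] e(2)[of n] by (auto intro: add_nonneg_pos)
      qed (use insert in auto)
      then have "of_real (c i) * ?S \<noteq> (0 :: complex)"
        using c by simp
      also have "of_real (c i) * ?S =
        mpoly_sum K (\<lambda>\<alpha>. of_real ((\<Prod>i\<in>insert i J. b n i (\<alpha> $ i)) * a \<alpha>)) z"
        unfolding mpoly_sum_def sum_distrib_left size
      proof (intro sum.cong refl)
        fix \<alpha>
        have "(\<Prod>(u, v)\<in>#?F. [:u, v:]) = (\<Prod>(u, v)\<in>#F i. [:u + e n, v + e n:])"
          by (simp add: image_mset.compositionality comp_def case_prod_unfold)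
        then have "c i * (coeff (\<Prod>(u, v)\<in>#?F. [:u, v:]) (\<alpha> $ i) / (N choose \<alpha> $ i)) = b n i (\<alpha> $ i)"
          by (simp add: b_def)
        moreover have "(\<Prod>i\<in>insert i J. b n i (\<alpha> $ i)) = b n i (\<alpha> $ i) * (\<Prod>i\<in>J. b n i (\<alpha> $ i))"
          using insert.hyps by simp
        ultimately show "of_real (c i) * (of_real (coeff (\<Prod>(u, v)\<in>#?F. [:u, v:]) (\<alpha> $ i) / (N choose \<alpha> $ i)) *
            of_real ((\<Prod>i\<in>J. b n i (\<alpha> $ i)) * a \<alpha>) * vmonom z \<alpha>) =
          of_real ((\<Prod>i\<in>insert i J. b n i (\<alpha> $ i)) * a \<alpha>) * vmonom z \<alpha>"
          by (metis (no_types, lifting) mult.assoc of_real_mult)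
      qed
      finally show ?case .
    qed
    have nzn: "mpoly_sum K (\<lambda>\<alpha>. of_real ((\<Prod>i\<in>UNIV. b n i (\<alpha> $ i)) * a \<alpha>)) z \<noteq> 0"
      if "uhp z" for n and z :: "complex ^ 'n"
      by (rule partial[OF finite that])
    have lim: "(\<lambda>n. complex_of_real ((\<Prod>i\<in>UNIV. b n i (\<alpha> $ i)) * a \<alpha>)) \<longlonglongrightarrow> of_real (?l \<alpha> * a \<alpha>)"
      if "\<alpha> \<in> K" for \<alpha>
      using N[OF that] by (intro tendsto_intros blim)
    \<comment> \<open>Hurwitz' theorem needs a point where the limit is nonzero; without such a
      point all coefficients of the image vanish.\<close>
    show ?thesis
    proof (cases "\<exists>w. uhp w \<and> mpoly_sum K (\<lambda>\<alpha>. of_real (?l \<alpha> * a \<alpha>)) w \<noteq> 0")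
      case True
      then show ?thesis using mpoly_sum_limit_nonzero[OF K nzn lim] by blast
    next
      case False
      then have "complex_of_real (?l \<alpha> * a \<alpha>) = 0" if "\<alpha> \<in> K" for \<alpha>
        using mpoly_sum_eq_0D[OF K _ that, of "\<lambda>\<alpha>. of_real (?l \<alpha> * a \<alpha>)"] by blast
      then show ?thesis by (simp only: of_real_eq_0_iff) blast
    qed
  qed
qed

section \<open>Slices of a multiplier sequence\<close>

text \<open>By the open mapping theorem a nonconstant image would contain a ball, but no ball lies
  on the real axis.\<close>

lemma holomorphic_real_valued_constant_on:
  assumes "f holomorphic_on S" "open S" "connected S" "\<And>t. t \<in> S \<Longrightarrow> Im (f t) = 0"
  shows "f constant_on S"
proof (rule ccontr)
  assume nc: "\<not> f constant_on S"
  then obtain t where t: "t \<in> S" by (auto simp: constant_on_def)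
  have "open (f ` S)"
    by (rule open_mapping_thm[OF assms(1-3) assms(2) order.refl nc])
  then obtain e where e: "e > 0" "ball (f t) e \<subseteq> f ` S"
    using t open_contains_ball by blast
  have "f t + \<i> * of_real (e / 2) \<in> ball (f t) e"
    using e(1) by (simp add: dist_norm norm_mult)
  then obtain s where "s \<in> S" "f t + \<i> * of_real (e / 2) = f s"
    using e(2) by blast
  then have "Im (f t + \<i> * of_real (e / 2)) = 0" using assms(4) by metis
  then show False using assms(4)[OF t] e(1) by simp
qed

text \<open>An argument in (0, 2 pi] divided by m \<ge> 3 lies strictly between 0 and pi. For m = 2
  both roots are real only if \<open>r\<close> is a positive real, and then \<open>- r\<close> has a
  root on the positive imaginary axis.\<close>

lemma root_in_upper_half_plane:
  fixes r :: complex
  assumes "r \<noteq> 0" "m \<ge> 2"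
  obtains x where "Im x > 0" "x ^ m = r \<or> m = 2 \<and> x\<^sup>2 = - r"
proof (cases "m = 2")
  case True
  define s where "s = csqrt r"
  have s: "s\<^sup>2 = r" by (simp add: s_def)
  consider "Im s > 0" | "Im s < 0" | "Im s = 0" by linarith
  then show thesis
  proof cases
    case 1
    then show ?thesis using that[of s] s True by simp
  next
    case 2
    then show ?thesis using that[of "- s"] s True by simp
  next
    case 3
    then have eq: "s = of_real (Re s)" by (simp add: complex_eq_iff)
    then have "Re s \<noteq> 0" using s assms(1) by auto
    moreover have "(\<i> * of_real \<bar>Re s\<bar>)\<^sup>2 = - ((of_real (Re s))\<^sup>2)"
      by (simp add: power_mult_distrib flip: of_real_power)
    ultimately show ?thesis
      using that[of "\<i> * of_real \<bar>Re s\<bar>"] s True eq by simp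
  qed
next
  case False
  \<comment> \<open>Argument 0 is replaced by 2 pi, as it would lead to a real root.\<close>
  define \<theta> where "\<theta> = (if Arg2pi r = 0 then 2 * pi else Arg2pi r)"
  have \<theta>: "0 < \<theta>" "\<theta> \<le> 2 * pi"
    using Arg2pi_ge_0[of r] Arg2pi_lt_2pi[of r] by (auto simp: \<theta>_def)
  have r: "r = of_real (cmod r) * cis \<theta>"
    using Arg2pi_eq[of r] by (auto simp: \<theta>_def cis_conv_exp mult.commute)
  define x where "x = of_real (root m (cmod r)) * cis (\<theta> / real m)"
  have "root m (cmod r) ^ m = cmod r"
    using assms(2) by (intro real_root_pow_pos2) auto
  then have "x ^ m = of_real (cmod r) * cis \<theta>"
    using assms(2) by (simp add: x_def power_mult_distrib Complex.DeMoivre flip: of_real_power)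
  then have "x ^ m = r" using r by simp
  moreover have "\<theta> / real m < pi"
  proof -
    have "\<theta> / real m \<le> 2 * pi / 3"
      using \<theta> False assms(2) by (intro frac_le) auto
    also have "\<dots> < pi" by simp
    finally show ?thesis .
  qed
  then have "sin (\<theta> / real m) > 0"
    using \<theta>(1) assms(2) by (intro sin_gt_zero) auto
  then have "Im x > 0"
    using assms by (simp add: x_def)
  ultimately show thesis using that by blast
qed

section \<open>Slice polynomials in one direction\<close>

definition slice_box :: "'n::finite \<Rightarrow> nat \<Rightarrow> (nat ^ 'n) set" where
  "slice_box i N = vec_lambda ` (PiE UNIV (\<lambda>j. if j = i then {0} else {..N}))"

text \<open>On \<open>slice_box i N\<close> these are the coefficients of the product of (1 + z_j)^N
  over all j other than \<open>i\<close>: the exponent 0 in direction \<open>i\<close> contributes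
  the factor 1.\<close>

definition binomial_weight :: "nat \<Rightarrow> nat ^ 'n::finite \<Rightarrow> real" where
  "binomial_weight N \<beta> = (\<Prod>j\<in>UNIV. real (N choose \<beta> $ j))"

text \<open>The coefficient of \<open>z\<^sub>i\<^sup>k\<close> in the image of
  \<open>(\<Sum>\<^sub>k z\<^sub>i\<^sup>k) \<Prod>\<^sub>j (1 + z\<^sub>j)\<^sup>N\<close>, the product being over \<open>j \<noteq> i\<close>.\<close>

definition slice_poly :: "(nat ^ 'n::finite \<Rightarrow> real) \<Rightarrow> 'n \<Rightarrow> nat \<Rightarrow> nat \<Rightarrow> complex ^ 'n \<Rightarrow> complex" where
  "slice_poly l i N k =
    mpoly_sum (slice_box i N) (\<lambda>\<beta>. of_real (l (vec_upd \<beta> i k) * binomial_weight N \<beta>))"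

lemma finite_slice_box: "finite (slice_box i N)"
  unfolding slice_box_def by (intro finite_imageI finite_PiE) auto

lemma mem_slice_box_iff: "\<beta> \<in> slice_box i N \<longleftrightarrow> \<beta> $ i = 0 \<and> (\<forall>j. \<beta> $ j \<le> N)"
proof
  assume "\<beta> \<in> slice_box i N"
  then obtain f where f: "\<beta> = vec_lambda f" "\<And>j. f j \<in> (if j = i then {0} else {..N})"
    by (auto simp: slice_box_def)
  have "f j \<le> N" for j using f(2)[of j] by (cases "j = i") auto
  then show "\<beta> $ i = 0 \<and> (\<forall>j. \<beta> $ j \<le> N)" using f(1) f(2)[of i] by simp
next
  assume "\<beta> $ i = 0 \<and> (\<forall>j. \<beta> $ j \<le> N)"
  then show "\<beta> \<in> slice_box i N"
    unfolding slice_box_def by (intro image_eqI[of _ _ "($) \<beta>"]) auto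
qed

lemma vec_upd_in_slice_box: "(\<And>j. \<alpha> $ j \<le> N) \<Longrightarrow> vec_upd \<alpha> i 0 \<in> slice_box i N"
  by (simp add: mem_slice_box_iff)

lemma nth_le_sum: "(\<alpha> :: nat ^ 'n::finite) $ j \<le> (\<Sum>i\<in>UNIV. \<alpha> $ i)"
  by (rule member_le_sum) auto

lemma binomial_weight_pos: "\<beta> \<in> slice_box i N \<Longrightarrow> binomial_weight N \<beta> > 0"
  unfolding binomial_weight_def by (intro prod_pos) (simp add: mem_slice_box_iff)

lemma slice_poly_vec_upd: "slice_poly l i N k (vec_upd z i x) = slice_poly l i N k z"
  unfolding slice_poly_def mpoly_sum_def
  by (intro sum.cong refl) (simp add: vmonom_vec_upd_0 mem_slice_box_iff)

lemma slice_poly_zero: "(\<And>\<alpha>. l (vec_upd \<alpha> i k) = 0) \<Longrightarrow> slice_poly l i N k z = 0"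
  unfolding slice_poly_def by (intro mpoly_sum_zero) simp

lemma mpoly_sum_binomial_weight_nonzero:
  assumes "uhp z"
  shows "mpoly_sum (slice_box i N) (\<lambda>\<beta>. of_real (binomial_weight N \<beta>)) z \<noteq> 0"
proof -
  let ?B = "\<lambda>j. if j = i then {0} else {..N}"
  have "inj_on vec_lambda (PiE UNIV ?B)" by (auto simp: inj_on_def)
  then have "mpoly_sum (slice_box i N) (\<lambda>\<beta>. of_real (binomial_weight N \<beta>)) z =
      (\<Sum>g\<in>PiE UNIV ?B. \<Prod>j\<in>UNIV. of_nat (N choose g j) * (z $ j) ^ g j)"
    by (simp add: mpoly_sum_def slice_box_def sum.reindex binomial_weight_def vmonom_def prod.distrib)
  \<comment> \<open>The encoding of the box as an image of \<open>PiE\<close> makes this an instance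
    of the distributive law.\<close>
  also have "\<dots> = (\<Prod>j\<in>UNIV. \<Sum>k\<in>?B j. of_nat (N choose k) * (z $ j) ^ k)"
    by (subst prod_sum_PiE) auto
  also have "\<dots> \<noteq> 0"
  proof -
    have "(\<Sum>k\<in>?B j. of_nat (N choose k) * (z $ j) ^ k) \<noteq> 0" for j
    proof (cases "j = i")
      case False
      have "(\<Sum>k\<le>N. of_nat (N choose k) * (z $ j) ^ k) = (z $ j + 1) ^ N"
        by (simp add: binomial_ring)
      moreover have "Im (z $ j + 1) > 0" using assms by (simp add: uhp_def)
      then have "z $ j + 1 \<noteq> 0" by force
      ultimately show ?thesis using False by simp
    qed simp
    then show ?thesis by (simp add: prod_zero_iff)
  qed
  finally show ?thesis .
qed

text \<open>Tests \<open>l\<close> on a univariate polynomial in direction \<open>i\<close> times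
  the product of (1 + z_j)^N over the other directions; sorting the image by powers of
  \<open>z $ i\<close> produces the slice polynomials. One surviving coefficient excludes a zero
  image.\<close>

lemma multiplier_sequence_slices:
  fixes l :: "nat ^ 'n::finite \<Rightarrow> real"
  assumes l: "multiplier_sequence l" and S: "finite S"
    and c: "\<And>x. Im x > 0 \<Longrightarrow> (\<Sum>k\<in>S. of_real (c k) * x ^ k) \<noteq> 0"
    and nz: "k \<in> S" "\<beta> \<in> slice_box i N" "c k * l (vec_upd \<beta> i k) \<noteq> 0" and z: "uhp z"
  shows "(\<Sum>k\<in>S. of_real (c k) * (z $ i) ^ k * slice_poly l i N k z) \<noteq> 0"
proof -
  let ?f = "\<lambda>(\<beta>, k). vec_upd \<beta> i k"
  let ?K = "?f ` (slice_box i N \<times> S)"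
  define a where "a \<alpha> = c (\<alpha> $ i) * binomial_weight N (vec_upd \<alpha> i 0)" for \<alpha>
  have slice_base: "vec_upd \<beta> i 0 = \<beta>" if "\<beta> \<in> slice_box i N" for \<beta>
    using that by (simp add: mem_slice_box_iff vec_eq_iff)
  have inj: "inj_on ?f (slice_box i N \<times> S)"
  proof (rule inj_onI, clarify)
    fix \<beta> k \<beta>' k' assume "\<beta> \<in> slice_box i N" "\<beta>' \<in> slice_box i N" "vec_upd \<beta> i k = vec_upd \<beta>' i k'"
    then show "\<beta> = \<beta>' \<and> k = k'"
      using slice_base by (metis vec_upd_nth vec_upd_upd)
  qed
  have split: "mpoly_sum ?K A w = (\<Sum>k\<in>S. (w $ i) ^ k * (\<Sum>\<beta>\<in>slice_box i N. A (vec_upd \<beta> i k) * vmonom w \<beta>))" for A w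
  proof -
    have "mpoly_sum ?K A w = (\<Sum>(\<beta>, k)\<in>slice_box i N \<times> S. A (vec_upd \<beta> i k) * vmonom w (vec_upd \<beta> i k))"
      unfolding mpoly_sum_def by (subst sum.reindex[OF inj]) (simp add: case_prod_unfold)
    also have "\<dots> = (\<Sum>\<beta>\<in>slice_box i N. \<Sum>k\<in>S. A (vec_upd \<beta> i k) * vmonom w (vec_upd \<beta> i k))"
      by (rule sum.cartesian_product[symmetric])
    also have "\<dots> = (\<Sum>k\<in>S. \<Sum>\<beta>\<in>slice_box i N. A (vec_upd \<beta> i k) * vmonom w (vec_upd \<beta> i k))"
      by (rule sum.swap)
    also have "\<dots> = (\<Sum>k\<in>S. (w $ i) ^ k * (\<Sum>\<beta>\<in>slice_box i N. A (vec_upd \<beta> i k) * vmonom w \<beta>))"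
      unfolding sum_distrib_left
      by (intro sum.cong refl) (subst vmonom_vec_upd_index, simp add: slice_base mult_ac)
    finally show ?thesis .
  qed
  have "mpoly_sum ?K (\<lambda>\<alpha>. of_real (a \<alpha>)) w \<noteq> 0" if w: "uhp w" for w
  proof -
    have "mpoly_sum ?K (\<lambda>\<alpha>. of_real (a \<alpha>)) w =
        (\<Sum>k\<in>S. of_real (c k) * (w $ i) ^ k) * mpoly_sum (slice_box i N) (\<lambda>\<beta>. of_real (binomial_weight N \<beta>)) w"
      unfolding split unfolding sum_distrib_right mpoly_sum_def
      by (intro sum.cong refl) (simp add: a_def sum_distrib_left slice_base mult_ac)
    then show ?thesis
      using mpoly_sum_binomial_weight_nonzero[OF w] c w by (simp add: uhp_def)
  qed
  then have "(\<forall>z. uhp z \<longrightarrow> mpoly_sum ?K (\<lambda>\<alpha>. of_real (l \<alpha> * a \<alpha>)) z \<noteq> 0) \<or> (\<forall>\<alpha>\<in>?K. l \<alpha> * a \<alpha> = 0)"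
    by (intro multiplier_sequenceD[OF l] finite_imageI finite_cartesian_product finite_slice_box S)
  moreover have "\<exists>\<alpha>\<in>?K. l \<alpha> * a \<alpha> \<noteq> 0"
  proof (rule bexI)
    show "vec_upd \<beta> i k \<in> ?K" using nz by force
    show "l (vec_upd \<beta> i k) * a (vec_upd \<beta> i k) \<noteq> 0"
      using nz binomial_weight_pos[OF nz(2)] by (simp add: a_def slice_base)
  qed
  ultimately have "mpoly_sum ?K (\<lambda>\<alpha>. of_real (l \<alpha> * a \<alpha>)) z \<noteq> 0" using z by blast
  also have "mpoly_sum ?K (\<lambda>\<alpha>. of_real (l \<alpha> * a \<alpha>)) z = (\<Sum>k\<in>S. of_real (c k) * (z $ i) ^ k * slice_poly l i N k z)"
    unfolding split unfolding slice_poly_def mpoly_sum_def sum_distrib_left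
    by (intro sum.cong refl) (simp add: a_def slice_base mult_ac)
  finally show ?thesis .
qed

lemma slice_poly_nonzero:
  assumes "multiplier_sequence l" "\<beta> \<in> slice_box i N" "l (vec_upd \<beta> i k) \<noteq> 0" "uhp z"
  shows "slice_poly l i N k z \<noteq> 0"
proof -
  have "(\<Sum>j\<in>{k}. of_real 1 * (z $ i) ^ j * slice_poly l i N j z) \<noteq> 0"
    by (rule multiplier_sequence_slices[where k = k and \<beta> = \<beta>]) (use assms in auto)
  then show ?thesis by simp
qed

text \<open>The tests \<open>z\<^sub>i\<^sup>k (1 \<plusminus> z\<^sub>i) h\<close> exclude that the quotient of two consecutive
  slice polynomials takes a value in either open half-plane.\<close>

lemma multiplier_sequence_adjacent_slices:
  fixes l :: "nat ^ 'n::finite \<Rightarrow> real"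
  assumes l: "multiplier_sequence l"
  shows "l (vec_upd \<alpha> i k) * l (vec_upd \<beta> i (Suc k)) = l (vec_upd \<alpha> i (Suc k)) * l (vec_upd \<beta> i k)"
proof -
  define N where "N = (\<Sum>j\<in>UNIV. \<alpha> $ j) + (\<Sum>j\<in>UNIV. \<beta> $ j)"
  have "\<alpha> $ j \<le> N" "\<beta> $ j \<le> N" for j
    using nth_le_sum[of \<alpha> j] nth_le_sum[of \<beta> j] by (simp_all add: N_def)
  then have box: "vec_upd \<alpha> i 0 \<in> slice_box i N" "vec_upd \<beta> i 0 \<in> slice_box i N"
    by (auto intro: vec_upd_in_slice_box)
  let ?B = "slice_box i N" and ?P = "slice_poly l i N"
  have "l (vec_upd \<gamma> i k) * l (vec_upd \<delta> i (Suc k)) = l (vec_upd \<gamma> i (Suc k)) * l (vec_upd \<delta> i k)"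
    if \<gamma>: "\<gamma> \<in> ?B" and \<delta>: "\<delta> \<in> ?B" for \<gamma> \<delta>
  proof (cases "(\<forall>\<beta>\<in>?B. l (vec_upd \<beta> i k) = 0) \<or> (\<forall>\<beta>\<in>?B. l (vec_upd \<beta> i (Suc k)) = 0)")
    case True
    then show ?thesis using \<gamma> \<delta> by auto
  next
    case False
    then obtain \<beta>0 \<beta>1 where b0: "\<beta>0 \<in> ?B" "l (vec_upd \<beta>0 i k) \<noteq> 0"
      and b1: "\<beta>1 \<in> ?B" "l (vec_upd \<beta>1 i (Suc k)) \<noteq> 0" by blast
    have P1: "?P (Suc k) z \<noteq> 0" if "uhp z" for z
      by (rule slice_poly_nonzero[OF l b1 that])
    have pm: "?P k z + of_real s * x * ?P (Suc k) z \<noteq> 0" if "uhp z" "Im x > 0" "s \<in> {1, -1}" for z x s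
    proof -
      let ?c = "\<lambda>j. if j = k then 1 else s"
      have lin: "1 + of_real s * y \<noteq> 0" if "Im y > 0" for y
        using that \<open>s \<in> {1, -1}\<close> by (auto simp: complex_eq_iff)
      have "(\<Sum>j\<in>{k, Suc k}. of_real (?c j) * (vec_upd z i x $ i) ^ j * ?P j (vec_upd z i x)) \<noteq> 0"
      proof (rule multiplier_sequence_slices[OF l, where k = k and \<beta> = \<beta>0])
        fix y :: complex assume y: "Im y > 0"
        have "(\<Sum>j\<in>{k, Suc k}. of_real (?c j) * y ^ j) = y ^ k * (1 + of_real s * y)"
          by (simp add: algebra_simps)
        then show "(\<Sum>j\<in>{k, Suc k}. of_real (?c j) * y ^ j) \<noteq> 0"
          using lin[OF y] y by auto
      qed (use b0 that in \<open>auto intro: uhp_vec_upd\<close>)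
      also have "(\<Sum>j\<in>{k, Suc k}. of_real (?c j) * (vec_upd z i x $ i) ^ j * ?P j (vec_upd z i x)) =
          x ^ k * (?P k z + of_real s * x * ?P (Suc k) z)"
        by (simp add: slice_poly_vec_upd algebra_simps)
      finally show ?thesis by simp
    qed
    \<comment> \<open>If the quotient were not real, it or its negative would be an admissible
      \<open>x\<close> violating \<open>pm\<close>.\<close>
    have real: "Im (?P k z / ?P (Suc k) z) = 0" if z: "uhp z" for z
    proof (rule ccontr)
      let ?R = "?P k z / ?P (Suc k) z"
      assume "Im ?R \<noteq> 0"
      then consider "Im ?R > 0" | "Im (- ?R) > 0" by fastforce
      then show False
        using pm[OF z, of ?R "-1"] pm[OF z, of "- ?R" 1] P1[OF z] by cases auto
    qed
    define z0 where "z0 = (\<chi> j :: 'n. \<i>)"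
    have z0: "uhp z0" by (simp add: uhp_def z0_def)
    define r where "r = ?P k z0 / ?P (Suc k) z0"
    \<comment> \<open>The quotient is holomorphic and real on the line joining \<open>z0\<close> to
      \<open>z\<close>, hence takes the same value at both points.\<close>
    have quot: "?P k z = r * ?P (Suc k) z" if z: "uhp z" for z
    proof -
      let ?S = "{t. uhp (complex_line z0 z t)}"
      let ?q = "\<lambda>t. ?P k (complex_line z0 z t) / ?P (Suc k) (complex_line z0 z t)"
      have "?q constant_on ?S"
      proof (rule holomorphic_real_valued_constant_on)
        show "?q holomorphic_on ?S"
          using P1 unfolding slice_poly_def
          by (intro holomorphic_intros holomorphic_mpoly_sum_complex_line) auto
      qed (use real in \<open>auto intro: open_complex_line_uhp connected_complex_line_uhp\<close>)
      then obtain c where c: "\<And>t. t \<in> ?S \<Longrightarrow> ?q t = c"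
        by (auto simp: constant_on_def)
      have "?q 0 = ?q 1" using c[of 0] c[of 1] z z0 by simp
      then show ?thesis using P1[OF z] by (simp add: r_def field_simps)
    qed
    \<comment> \<open>Comparing coefficients turns the identity of polynomials into proportionality
      of the two slices of \<open>l\<close>.\<close>
    have coeff: "of_real (l (vec_upd \<beta> i k)) = r * of_real (l (vec_upd \<beta> i (Suc k)))" if "\<beta> \<in> ?B" for \<beta>
    proof -
      let ?d = "\<lambda>\<beta>. of_real (l (vec_upd \<beta> i k) * binomial_weight N \<beta>) -
        r * of_real (l (vec_upd \<beta> i (Suc k)) * binomial_weight N \<beta>)"
      have "mpoly_sum ?B ?d z = 0" if "uhp z" for z
      proof -
        have "mpoly_sum ?B ?d z = ?P k z - r * ?P (Suc k) z"
          unfolding slice_poly_def mpoly_sum_def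
          by (simp add: sum_distrib_left sum_subtractf[symmetric] ring_distribs mult_ac)
        then show ?thesis using quot[OF that] by simp
      qed
      then have "?d \<beta> = 0" using mpoly_sum_eq_0D[OF finite_slice_box _ that, of ?d] by blast
      then show ?thesis using binomial_weight_pos[OF that] by simp
    qed
    have "complex_of_real (l (vec_upd \<gamma> i k) * l (vec_upd \<delta> i (Suc k))) =
        of_real (l (vec_upd \<gamma> i (Suc k)) * l (vec_upd \<delta> i k))"
      using coeff[OF \<gamma>] coeff[OF \<delta>] by simp
    then show ?thesis by (simp only: of_real_eq_iff)
  qed
  from this[OF box] show ?thesis by simp
qed

text \<open>With only two surviving slices, the test \<open>z\<^sub>i\<^sup>k (1 + z\<^sub>i)\<^sup>m h\<close> would need a
  number without \<open>m\<close>-th root in the upper half-plane. This exists only for \<open>m = 2\<close>,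
  where the test \<open>z\<^sub>i\<^sup>k (1 - z\<^sub>i\<^sup>2) h\<close> excludes it.\<close>

lemma multiplier_sequence_isolated_slices:
  fixes l :: "nat ^ 'n::finite \<Rightarrow> real"
  assumes l: "multiplier_sequence l" and m: "m \<ge> 2"
    and gap: "\<And>j \<alpha>. k < j \<Longrightarrow> j < k + m \<Longrightarrow> l (vec_upd \<alpha> i j) = 0"
    and \<alpha>: "l (vec_upd \<alpha> i k) \<noteq> 0" and \<beta>: "l (vec_upd \<beta> i (k + m)) \<noteq> 0"
  shows False
proof -
  define N where "N = (\<Sum>j\<in>UNIV. \<alpha> $ j) + (\<Sum>j\<in>UNIV. \<beta> $ j)"
  have "\<alpha> $ j \<le> N" "\<beta> $ j \<le> N" for j
    using nth_le_sum[of \<alpha> j] nth_le_sum[of \<beta> j] by (simp_all add: N_def)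
  then have box: "vec_upd \<alpha> i 0 \<in> slice_box i N" "vec_upd \<beta> i 0 \<in> slice_box i N"
    by (auto intro: vec_upd_in_slice_box)
  let ?P = "slice_poly l i N"
  define z where "z = (\<chi> j :: 'n. \<i>)"
  have z: "uhp z" by (simp add: uhp_def z_def)
  have P: "?P k z \<noteq> 0" "?P (k + m) z \<noteq> 0"
    using slice_poly_nonzero[OF l box(1) _ z] slice_poly_nonzero[OF l box(2) _ z] \<alpha> \<beta> by auto
  \<comment> \<open>Slice polynomials are free of the variable in direction \<open>i\<close>, so
    \<open>x\<close> moves while their values stay fixed; the gap removes the intermediate binomial
    terms.\<close>
  have plus: "?P k z + x ^ m * ?P (k + m) z \<noteq> 0" if x: "Im x > 0" for x
  proof -
    let ?c = "\<lambda>j. real (m choose (j - k))"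
    have "(\<Sum>j\<in>{k..k+m}. of_real (?c j) * (vec_upd z i x $ i) ^ j * ?P j (vec_upd z i x)) \<noteq> 0"
    proof (rule multiplier_sequence_slices[OF l, where k = k and \<beta> = "vec_upd \<alpha> i 0"])
      fix y :: complex assume y: "Im y > 0"
      have "(\<Sum>j\<in>{k..k+m}. of_real (?c j) * y ^ j) = (\<Sum>j\<le>m. of_real (real (m choose j)) * y ^ (j + k))"
        by (rule sum.reindex_bij_witness[of _ "\<lambda>j. j + k" "\<lambda>j. j - k"]) auto
      also have "\<dots> = y ^ k * (y + 1) ^ m"
        by (simp add: binomial_ring sum_distrib_left power_add mult_ac)
      finally have "(\<Sum>j\<in>{k..k+m}. of_real (?c j) * y ^ j) = y ^ k * (y + 1) ^ m" .
      moreover have "y \<noteq> 0" "y + 1 \<noteq> 0" using y by (auto simp: complex_eq_iff)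
      ultimately show "(\<Sum>j\<in>{k..k+m}. of_real (?c j) * y ^ j) \<noteq> 0" by simp
    qed (use x z \<alpha> box in \<open>auto intro: uhp_vec_upd\<close>)
    also have "(\<Sum>j\<in>{k..k+m}. of_real (?c j) * (vec_upd z i x $ i) ^ j * ?P j (vec_upd z i x)) =
        (\<Sum>j\<in>{k, k+m}. of_real (?c j) * x ^ j * ?P j z)"
      unfolding slice_poly_vec_upd
      by (intro sum.mono_neutral_cong_right) (auto intro!: slice_poly_zero gap)
    also have "\<dots> = x ^ k * (?P k z + x ^ m * ?P (k + m) z)"
      using m by (simp add: power_add algebra_simps)
    finally show ?thesis by simp
  qed
  have minus: "?P k z - x\<^sup>2 * ?P (k + 2) z \<noteq> 0" if x: "Im x > 0" for x
  proof -
    let ?c = "\<lambda>j. if j = k then 1 else - 1 :: real"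
    have "(\<Sum>j\<in>{k, k+2}. of_real (?c j) * (vec_upd z i x $ i) ^ j * ?P j (vec_upd z i x)) \<noteq> 0"
    proof (rule multiplier_sequence_slices[OF l, where k = k and \<beta> = "vec_upd \<alpha> i 0"])
      fix y :: complex assume y: "Im y > 0"
      have "(\<Sum>j\<in>{k, k+2}. of_real (?c j) * y ^ j) = y ^ k * ((1 + y) * (1 - y))"
        by (simp add: algebra_simps power2_eq_square)
      moreover have "y \<noteq> 0" "1 + y \<noteq> 0" "1 - y \<noteq> 0" using y by (auto simp: complex_eq_iff)
      ultimately show "(\<Sum>j\<in>{k, k+2}. of_real (?c j) * y ^ j) \<noteq> 0" by simp
    qed (use x z \<alpha> box in \<open>auto intro: uhp_vec_upd\<close>)
    also have "(\<Sum>j\<in>{k, k+2}. of_real (?c j) * (vec_upd z i x $ i) ^ j * ?P j (vec_upd z i x)) =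
        x ^ k * (?P k z - x\<^sup>2 * ?P (k + 2) z)"
      by (simp add: slice_poly_vec_upd power2_eq_square algebra_simps)
    finally show ?thesis by simp
  qed
  have "- (?P k z / ?P (k + m) z) \<noteq> 0" using P by simp
  \<comment> \<open>This \<open>x\<close> is a zero of the expression in \<open>plus\<close> or, for
    m = 2, possibly of that in \<open>minus\<close>.\<close>
  then obtain x where "Im x > 0" "x ^ m = - (?P k z / ?P (k + m) z) \<or> m = 2 \<and> x\<^sup>2 = - (- (?P k z / ?P (k + m) z))"
    using root_in_upper_half_plane[OF _ m] by metis
  then show False using plus[of x] minus[of x] P by auto
qed

text \<open>Strong induction on \<open>b - a\<close>: a nonzero slice strictly between the endpoints
  replaces one of them, keeping \<open>j\<close> enclosed; if there is none, the endpoints are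
  isolated slices, which is impossible.\<close>

lemma multiplier_sequence_slices_interval:
  fixes l :: "nat ^ 'n::finite \<Rightarrow> real"
  assumes l: "multiplier_sequence l"
    and "l (vec_upd \<alpha> i a) \<noteq> 0" "l (vec_upd \<beta> i b) \<noteq> 0" "a \<le> j" "j \<le> b"
  shows "\<exists>\<gamma>. l (vec_upd \<gamma> i j) \<noteq> 0"
  using assms(2-)
proof (induction "b - a" arbitrary: a b \<alpha> \<beta> rule: less_induct)
  case less
  show ?case
  proof (cases "j = a \<or> j = b")
    case True
    then show ?thesis using less.prems by blast
  next
    case False
    then have j: "a < j" "j < b" using less.prems by auto
    show ?thesis
    proof (cases "\<exists>c \<gamma>. a < c \<and> c < b \<and> l (vec_upd \<gamma> i c) \<noteq> 0")
      case True
      then obtain c \<gamma> where c: "a < c" "c < b" "l (vec_upd \<gamma> i c) \<noteq> 0" by blast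
      show ?thesis
      proof (cases "j \<le> c")
        case True
        show ?thesis by (rule less.hyps[of c a \<alpha> \<gamma>]) (use c True less.prems in auto)
      next
        case False
        show ?thesis by (rule less.hyps[of b c \<gamma> \<beta>]) (use c False less.prems in auto)
      qed
    next
      case False
      have "a + (b - a) = b" using j by simp
      with multiplier_sequence_isolated_slices[OF l, of "b - a" a i \<alpha> \<beta>] False less.prems j
      have False by auto
      then show ?thesis ..
    qed
  qed
qed

text \<open>Chains the relations between adjacent slices. A nonzero entry \<open>\<gamma>\<close> of
  slice \<open>n\<close> links slices \<open>a\<close> and \<open>Suc n\<close> and is cancelled at
  the end; if slice \<open>n\<close> vanishes, so does one of those two, and both sides are
  zero.\<close>

lemma multiplier_sequence_rank_one:
  fixes l :: "nat ^ 'n::finite \<Rightarrow> real"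
  assumes l: "multiplier_sequence l"
  shows "l (vec_upd \<alpha> i a) * l (vec_upd \<beta> i b) = l (vec_upd \<alpha> i b) * l (vec_upd \<beta> i a)"
proof -
  have "l (vec_upd \<alpha> i a) * l (vec_upd \<beta> i b) = l (vec_upd \<alpha> i b) * l (vec_upd \<beta> i a)"
    if "a \<le> b" for a b \<alpha> \<beta>
    using that
  proof (induction b arbitrary: \<alpha> \<beta> rule: dec_induct)
    case base
    show ?case by (simp add: mult.commute)
  next
    case (step n)
    have adj: "l (vec_upd \<alpha> i n) * l (vec_upd \<beta> i (Suc n)) = l (vec_upd \<alpha> i (Suc n)) * l (vec_upd \<beta> i n)" for \<alpha> \<beta>
      by (rule multiplier_sequence_adjacent_slices[OF l])
    show ?case
    proof (cases "\<exists>\<gamma>. l (vec_upd \<gamma> i n) \<noteq> 0")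
      case True
      then obtain \<gamma> where \<gamma>: "l (vec_upd \<gamma> i n) \<noteq> 0" by blast
      let ?a = "\<lambda>\<alpha>. l (vec_upd \<alpha> i a)" and ?n = "\<lambda>\<alpha>. l (vec_upd \<alpha> i n)" and ?s = "\<lambda>\<alpha>. l (vec_upd \<alpha> i (Suc n))"
      have "(?a \<alpha> * ?s \<beta>) * (?n \<gamma> * ?n \<gamma>) = (?a \<alpha> * ?n \<gamma>) * (?n \<gamma> * ?s \<beta>)" by simp
      also have "\<dots> = (?n \<alpha> * ?a \<gamma>) * (?s \<gamma> * ?n \<beta>)" using step.IH adj by simp
      also have "\<dots> = (?n \<alpha> * ?s \<gamma>) * (?a \<gamma> * ?n \<beta>)" by simp
      also have "\<dots> = (?s \<alpha> * ?n \<gamma>) * (?n \<gamma> * ?a \<beta>)" using step.IH adj by simp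
      also have "\<dots> = (?s \<alpha> * ?a \<beta>) * (?n \<gamma> * ?n \<gamma>)" by simp
      finally show ?thesis using \<gamma> by simp
    next
      case False
      then have "l (vec_upd \<alpha> i a) = 0 \<or> l (vec_upd \<beta> i (Suc n)) = 0" for \<alpha> \<beta>
        using multiplier_sequence_slices_interval[OF l, of \<alpha> i a \<beta> "Suc n" n] step.hyps by auto
      then show ?thesis by (metis mult_eq_0_iff)
    qed
  qed
  then show ?thesis
    by (metis mult.commute nat_le_linear)
qed

section \<open>Factorisation and signs\<close>

lemma multiplier_sequence_scale:
  assumes l: "multiplier_sequence l"
  shows "multiplier_sequence (\<lambda>\<alpha>. c * l \<alpha>)"
  unfolding multiplier_sequence_iff
proof (intro allI impI)
  fix K :: "(nat ^ 'a) set" and a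
  assume K: "finite K" and nz: "\<forall>z. uhp z \<longrightarrow> mpoly_sum K (\<lambda>\<alpha>. of_real (a \<alpha>)) z \<noteq> 0"
  have sc: "mpoly_sum K (\<lambda>\<alpha>. of_real (c * l \<alpha> * a \<alpha>)) z = of_real c * mpoly_sum K (\<lambda>\<alpha>. of_real (l \<alpha> * a \<alpha>)) z" for z
    by (simp add: mpoly_sum_def sum_distrib_left mult.assoc)
  have "(\<forall>z. uhp z \<longrightarrow> mpoly_sum K (\<lambda>\<alpha>. of_real (l \<alpha> * a \<alpha>)) z \<noteq> 0) \<or> (\<forall>\<alpha>\<in>K. l \<alpha> * a \<alpha> = 0)"
    by (rule multiplier_sequenceD[OF l K]) (use nz in blast)
  then show "(\<forall>z. uhp z \<longrightarrow> mpoly_sum K (\<lambda>\<alpha>. of_real (c * l \<alpha> * a \<alpha>)) z \<noteq> 0) \<or> (\<forall>\<alpha>\<in>K. c * l \<alpha> * a \<alpha> = 0)"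
    unfolding sc by (cases "c = 0") auto
qed

text \<open>For real coefficients f(-z) is the conjugate of f(-cnj z), and -cnj preserves the upper
  half-plane; so the substitution of -z preserves stability, and it commutes with diagonal
  operators.\<close>

lemma multiplier_sequence_alternate:
  assumes l: "multiplier_sequence (l :: nat ^ 'n::finite \<Rightarrow> real)"
  shows "multiplier_sequence (\<lambda>\<alpha>. (-1) ^ index_size \<alpha> * l \<alpha>)"
  unfolding multiplier_sequence_iff
proof (intro allI impI)
  fix K :: "(nat ^ 'n) set" and a
  assume K: "finite K" and nz: "\<forall>z. uhp z \<longrightarrow> mpoly_sum K (\<lambda>\<alpha>. of_real (a \<alpha>)) z \<noteq> 0"
  let ?s = "\<lambda>\<alpha> :: nat ^ 'n. (-1) ^ index_size \<alpha> :: real"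
  have "mpoly_sum K (\<lambda>\<alpha>. of_real (?s \<alpha> * a \<alpha>)) z \<noteq> 0" if z: "uhp z" for z
  proof -
    let ?w = "\<chi> j. - cnj (z $ j)"
    have vm: "of_real (?s \<alpha>) * vmonom z \<alpha> = cnj (vmonom ?w \<alpha>)" for \<alpha>
    proof -
      have "cnj (vmonom ?w \<alpha>) = (\<Prod>j\<in>UNIV. (-1) ^ (\<alpha> $ j) * (z $ j) ^ (\<alpha> $ j))"
        by (simp add: vmonom_def flip: power_mult_distrib)
      then show ?thesis
        by (simp add: prod.distrib vmonom_def index_size_def power_sum)
    qed
    have "mpoly_sum K (\<lambda>\<alpha>. of_real (?s \<alpha> * a \<alpha>)) z = (\<Sum>\<alpha>\<in>K. of_real (a \<alpha>) * (of_real (?s \<alpha>) * vmonom z \<alpha>))"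
      unfolding mpoly_sum_def by (intro sum.cong refl) (simp add: mult_ac)
    also have "\<dots> = cnj (mpoly_sum K (\<lambda>\<alpha>. of_real (a \<alpha>)) ?w)"
      unfolding vm by (simp add: mpoly_sum_def)
    finally have "mpoly_sum K (\<lambda>\<alpha>. of_real (?s \<alpha> * a \<alpha>)) z = cnj (mpoly_sum K (\<lambda>\<alpha>. of_real (a \<alpha>)) ?w)" .
    moreover have "uhp ?w" using z by (simp add: uhp_def)
    ultimately show ?thesis using nz by simp
  qed
  then have "(\<forall>z. uhp z \<longrightarrow> mpoly_sum K (\<lambda>\<alpha>. of_real (l \<alpha> * (?s \<alpha> * a \<alpha>))) z \<noteq> 0) \<or>
      (\<forall>\<alpha>\<in>K. l \<alpha> * (?s \<alpha> * a \<alpha>) = 0)"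
    by (rule multiplier_sequenceD[OF l K])
  moreover have "l \<alpha> * (?s \<alpha> * a \<alpha>) = ?s \<alpha> * l \<alpha> * a \<alpha>" for \<alpha>
    by (simp only: mult_ac)
  ultimately show "(\<forall>z. uhp z \<longrightarrow> mpoly_sum K (\<lambda>\<alpha>. of_real (?s \<alpha> * l \<alpha> * a \<alpha>)) z \<noteq> 0) \<or>
      (\<forall>\<alpha>\<in>K. ?s \<alpha> * l \<alpha> * a \<alpha> = 0)"
    by (simp only:)
qed

lemma univariate_multiplier_sequence_alternate:
  "univariate_multiplier_sequence m \<Longrightarrow> univariate_multiplier_sequence (\<lambda>k. (-1) ^ k * m k)"
  unfolding univariate_multiplier_sequence_def
  by (drule multiplier_sequence_alternate) (simp add: index_size_def UNIV_1)

text \<open>Tests \<open>l\<close> on univariate polynomials in direction \<open>i\<close> times the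
  monomial with the exponents of \<open>\<alpha>\<close> in the other directions, which has no zeros
  on the half-planes.\<close>

lemma univariate_multiplier_sequence_slice:
  fixes l :: "nat ^ 'n::finite \<Rightarrow> real"
  assumes l: "multiplier_sequence l"
  shows "univariate_multiplier_sequence (\<lambda>k. l (vec_upd \<alpha> i k))"
  unfolding univariate_multiplier_sequence_def multiplier_sequence_iff
proof (intro allI impI)
  fix K :: "(nat ^ 1) set" and a
  assume K: "finite K" and nz: "\<forall>z. uhp z \<longrightarrow> mpoly_sum K (\<lambda>\<alpha>. of_real (a \<alpha>)) z \<noteq> 0"
  let ?f = "\<lambda>\<kappa> :: nat ^ 1. vec_upd \<alpha> i (\<kappa> $ 1)"
  let ?a = "\<lambda>\<gamma>. a (vec (\<gamma> $ i))"
  have inj: "inj_on ?f K"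
  proof (rule inj_onI)
    fix \<kappa> \<kappa>' :: "nat ^ 1" assume "?f \<kappa> = ?f \<kappa>'"
    then have "?f \<kappa> $ i = ?f \<kappa>' $ i" by (simp only:)
    then show "\<kappa> = \<kappa>'" by (simp add: vec_eq_iff)
  qed
  have vec1: "vec (\<kappa> $ 1) = \<kappa>" for \<kappa> :: "nat ^ 1"
    by (simp add: vec_eq_iff)
  have sum_K: "mpoly_sum (?f ` K) (\<lambda>\<gamma>. of_real (g \<gamma>)) z =
      vmonom z (vec_upd \<alpha> i 0) * mpoly_sum K (\<lambda>\<kappa>. of_real (g (?f \<kappa>))) (vec (z $ i))" for g z
  proof -
    have "mpoly_sum (?f ` K) (\<lambda>\<gamma>. of_real (g \<gamma>)) z = (\<Sum>\<kappa>\<in>K. of_real (g (?f \<kappa>)) * vmonom z (?f \<kappa>))"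
      unfolding mpoly_sum_def by (subst sum.reindex[OF inj]) simp
    also have "\<dots> = (\<Sum>\<kappa>\<in>K. of_real (g (?f \<kappa>)) * ((z $ i) ^ (\<kappa> $ 1) * vmonom z (vec_upd \<alpha> i 0)))"
      by (subst vmonom_vec_upd_index) (rule refl)
    finally show ?thesis
      by (simp add: mpoly_sum_def vmonom_1 sum_distrib_left mult_ac)
  qed
  have "mpoly_sum (?f ` K) (\<lambda>\<gamma>. of_real (?a \<gamma>)) z \<noteq> 0" if z: "uhp z" for z
  proof -
    have "uhp (vec (z $ i) :: complex ^ 1)" using z by (simp add: uhp_def)
    then show ?thesis
      using nz vmonom_nonzero[OF z, of "vec_upd \<alpha> i 0"] unfolding sum_K by (simp add: vec1)
  qed
  from multiplier_sequenceD[OF l finite_imageI[OF K] this]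
  show "(\<forall>w :: complex ^ 1. uhp w \<longrightarrow> mpoly_sum K (\<lambda>\<kappa>. of_real (l (?f \<kappa>) * a \<kappa>)) w \<noteq> 0) \<or>
      (\<forall>\<kappa>\<in>K. l (?f \<kappa>) * a \<kappa> = 0)"
  proof
    assume *: "\<forall>z. uhp z \<longrightarrow> mpoly_sum (?f ` K) (\<lambda>\<gamma>. of_real (l \<gamma> * ?a \<gamma>)) z \<noteq> 0"
    have "mpoly_sum K (\<lambda>\<kappa>. of_real (l (?f \<kappa>) * a \<kappa>)) w \<noteq> 0" if w: "uhp w" for w :: "complex ^ 1"
    proof -
      define z where "z = (vec (w $ 1) :: complex ^ 'n)"
      have z: "uhp z" using w by (simp add: uhp_def z_def)
      have "vec (z $ i) = w" by (simp add: z_def vec_eq_iff)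
      then show ?thesis
        using *[rule_format, OF z] unfolding sum_K by (simp add: vec1)
    qed
    then show ?thesis by blast
  next
    assume "\<forall>\<gamma>\<in>?f ` K. l \<gamma> * ?a \<gamma> = 0"
    then show ?thesis by (simp add: vec1)
  qed
qed

text \<open>Since \<open>z\<^sub>i z\<^sub>j\<close> omits exactly the positive reals, the stable polynomial
  \<open>z\<^sup>\<alpha> (1 - z\<^sub>i z\<^sub>j)\<close> detects the sign.\<close>

lemma multiplier_sequence_sign:
  fixes l :: "nat ^ 'n::finite \<Rightarrow> real"
  assumes l: "multiplier_sequence l"
  shows "l \<alpha> * l (\<alpha> + axis i 1 + axis j 1) \<ge> 0"
proof (rule ccontr)
  define \<gamma> where "\<gamma> = \<alpha> + axis i 1 + axis j 1"
  assume "\<not> l \<alpha> * l (\<alpha> + axis i 1 + axis j 1) \<ge> 0"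
  then have neg: "l \<alpha> * l \<gamma> < 0" by (simp add: \<gamma>_def)
  then have ne: "\<alpha> \<noteq> \<gamma>" by (metis not_square_less_zero)
  have vm: "vmonom z \<gamma> = vmonom z \<alpha> * (z $ i * z $ j)" for z
    by (simp add: \<gamma>_def vmonom_add vmonom_axis)
  let ?a = "\<lambda>\<beta>. if \<beta> = \<alpha> then 1 else - 1 :: real"
  have "mpoly_sum {\<alpha>, \<gamma>} (\<lambda>\<beta>. of_real (?a \<beta>)) z \<noteq> 0" if z: "uhp z" for z
  proof -
    have "z $ i * z $ j \<noteq> 1"
    proof
      assume "z $ i * z $ j = 1"
      then have "z $ j = inverse (z $ i)" by (metis inverse_unique)
      moreover have "Im (z $ i) > 0" "Im (z $ j) > 0" using z by (simp_all add: uhp_def)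
      ultimately show False by (simp add: divide_less_0_iff zero_less_divide_iff) (smt (verit) zero_le_power2)
    qed
    moreover have "mpoly_sum {\<alpha>, \<gamma>} (\<lambda>\<beta>. of_real (?a \<beta>)) z = vmonom z \<alpha> * (1 - z $ i * z $ j)"
      using ne by (simp add: mpoly_sum_def vm algebra_simps)
    ultimately show ?thesis using vmonom_nonzero[OF z] by simp
  qed
  then have "(\<forall>z. uhp z \<longrightarrow> mpoly_sum {\<alpha>, \<gamma>} (\<lambda>\<beta>. of_real (l \<beta> * ?a \<beta>)) z \<noteq> 0) \<or>
      (\<forall>\<beta>\<in>{\<alpha>, \<gamma>}. l \<beta> * ?a \<beta> = 0)"
    by (intro multiplier_sequenceD[OF l]) simp_all
  moreover have "l \<alpha> \<noteq> 0" "l \<gamma> \<noteq> 0" using neg by auto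
  ultimately have nz: "mpoly_sum {\<alpha>, \<gamma>} (\<lambda>\<beta>. of_real (l \<beta> * ?a \<beta>)) z \<noteq> 0" if "uhp z" for z
    using that by force
  \<comment> \<open>At the point with all coordinates equal to \<open>\<i> * s\<close>, products of
    two coordinates are -s^2. This \<open>s\<close> makes the image vanish there; it exists because
    \<open>l \<alpha>\<close> and \<open>l \<gamma>\<close> have opposite signs.\<close>
  define s where "s = sqrt (- l \<alpha> / l \<gamma>)"
  have q: "- l \<alpha> / l \<gamma> > 0" using neg by (auto simp: divide_less_0_iff zero_less_divide_iff mult_less_0_iff)
  then have s: "s > 0" "s\<^sup>2 = - l \<alpha> / l \<gamma>" by (simp_all add: s_def)
  define z where "z = (\<chi> k :: 'n. \<i> * of_real s)"
  have z: "uhp z" using s by (simp add: uhp_def z_def)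
  have "z $ i * z $ j = (\<i> * \<i>) * of_real (s\<^sup>2)"
    by (simp only: z_def vec_lambda_beta power2_eq_square of_real_mult mult_ac)
  then have "z $ i * z $ j = - of_real (s\<^sup>2)" by simp
  then have "mpoly_sum {\<alpha>, \<gamma>} (\<lambda>\<beta>. of_real (l \<beta> * ?a \<beta>)) z = vmonom z \<alpha> * of_real (l \<alpha> + l \<gamma> * s\<^sup>2)"
    using ne by (simp add: mpoly_sum_def vm algebra_simps)
  also have "l \<alpha> + l \<gamma> * s\<^sup>2 = 0" using s \<open>l \<gamma> \<noteq> 0\<close> by simp
  finally show False using nz[OF z] by simp
qed

section \<open>Sign patterns of sequences with interval support\<close>

definition interval_support :: "(nat \<Rightarrow> real) \<Rightarrow> bool" where
  "interval_support f \<longleftrightarrow> (\<forall>a j b. a \<le> j \<longrightarrow> j \<le> b \<longrightarrow> f a \<noteq> 0 \<longrightarrow> f b \<noteq> 0 \<longrightarrow> f j \<noteq> 0)"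

lemma interval_supportD: "interval_support f \<Longrightarrow> f a \<noteq> 0 \<Longrightarrow> f b \<noteq> 0 \<Longrightarrow> a \<le> j \<Longrightarrow> j \<le> b \<Longrightarrow> f j \<noteq> 0"
  by (auto simp: interval_support_def)

text \<open>Signs propagate from neighbour to neighbour: the factor \<open>(f n)\<^sup>2\<close>
  inserts an intermediate entry, which is nonzero because the support has no gaps.\<close>

lemma interval_support_same_sign:
  assumes f: "interval_support f" and adj: "\<And>k. f k * f (Suc k) \<ge> 0"
  shows "f k * f k' \<ge> 0"
proof -
  have "f k * f k' \<ge> 0" if "k \<le> k'" for k k'
    using that
  proof (induction k' rule: dec_induct)
    case base
    show ?case by simp
  next
    case (step n)
    show ?case
    proof (cases "f k = 0 \<or> f (Suc n) = 0")
      case False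
      then have "f n \<noteq> 0" using interval_supportD[OF f, of k "Suc n" n] step.hyps by auto
      have "(f k * f (Suc n)) * (f n)\<^sup>2 = (f k * f n) * (f n * f (Suc n))"
        by (simp add: power2_eq_square)
      also have "\<dots> \<ge> 0" using step.IH adj by simp
      finally show ?thesis using \<open>f n \<noteq> 0\<close> by (simp add: zero_le_mult_iff)
    qed auto
  qed
  then show ?thesis by (metis mult.commute nat_le_linear)
qed

text \<open>The products of neighbours again have interval support, and two consecutive ones
  multiply to \<open>f k * f (Suc (Suc k))\<close> times a square, so signs propagate among them as
  well.\<close>

lemma interval_support_adjacent_products:
  assumes f: "interval_support f" and two: "\<And>k. f k * f (Suc (Suc k)) \<ge> 0"
  shows "(f a * f (Suc a)) * (f b * f (Suc b)) \<ge> 0"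
proof (rule interval_support_same_sign[where f = "\<lambda>k. f k * f (Suc k)"])
  show "interval_support (\<lambda>k. f k * f (Suc k))"
    unfolding interval_support_def
  proof (intro allI impI)
    fix a j b assume j: "a \<le> j" "j \<le> b" and "f a * f (Suc a) \<noteq> 0" "f b * f (Suc b) \<noteq> 0"
    then have "f a \<noteq> 0" "f (Suc b) \<noteq> 0" by auto
    then show "f j * f (Suc j) \<noteq> 0"
      using interval_supportD[OF f, of a "Suc b" j] interval_supportD[OF f, of a "Suc b" "Suc j"] j by simp
  qed
  show "f k * f (Suc k) * (f (Suc k) * f (Suc (Suc k))) \<ge> 0" for k
    using mult_nonneg_nonneg[OF two[of k] zero_le_square[of "f (Suc k)"]] by (simp add: mult_ac)
qed

text \<open>The coordinates of \<open>\<alpha>0\<close> are replaced by those of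
  \<open>\<alpha>\<close> one at a time; by rank one each replacement contributes a ratio
  independent of the other coordinates.\<close>

lemma multiplier_sequence_product:
  fixes l :: "nat ^ 'n::finite \<Rightarrow> real"
  assumes l: "multiplier_sequence l" and \<alpha>0: "l \<alpha>0 \<noteq> 0"
  shows "l \<alpha> = l \<alpha>0 * (\<Prod>i\<in>UNIV. l (vec_upd \<alpha>0 i (\<alpha> $ i)) / l \<alpha>0)"
proof -
  let ?g = "\<lambda>J. (\<chi> j. if j \<in> J then \<alpha> $ j else \<alpha>0 $ j)"
  have "l (?g J) = l \<alpha>0 * (\<Prod>i\<in>J. l (vec_upd \<alpha>0 i (\<alpha> $ i)) / l \<alpha>0)" if "finite J" for J :: "'n set"
    using that
  proof (induction J)
    case (insert i J)
    have "l (vec_upd (?g J) i (\<alpha> $ i)) * l (vec_upd \<alpha>0 i (\<alpha>0 $ i)) =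
        l (vec_upd (?g J) i (\<alpha>0 $ i)) * l (vec_upd \<alpha>0 i (\<alpha> $ i))"
      by (rule multiplier_sequence_rank_one[OF l])
    moreover have "vec_upd (?g J) i (\<alpha> $ i) = ?g (insert i J)" "vec_upd (?g J) i (\<alpha>0 $ i) = ?g J"
      using insert.hyps by (auto simp: vec_eq_iff)
    ultimately have "l (?g (insert i J)) = l (?g J) * (l (vec_upd \<alpha>0 i (\<alpha> $ i)) / l \<alpha>0)"
      using \<alpha>0 by (simp add: field_simps)
    then show ?case using insert by simp
  qed simp
  from this[of UNIV] show ?thesis by simp
qed

text \<open>By the product formula only the lines \<open>u i\<close> through
  \<open>\<alpha>0\<close> matter. Their products of neighbours share one sign: within a line by the
  sign test with i = j, across lines by the test with distinct directions. Nonnegative products give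
  constant signs, nonpositive ones alternating signs.\<close>

lemma multiplier_sequence_signs:
  fixes l :: "nat ^ 'n::finite \<Rightarrow> real"
  assumes l: "multiplier_sequence l"
  shows "(\<forall>\<alpha> \<beta>. l \<alpha> * l \<beta> \<ge> 0) \<or> (\<forall>\<alpha> \<beta>. (-1) ^ (index_size \<alpha> + index_size \<beta>) * l \<alpha> * l \<beta> \<ge> 0)"
proof (cases "\<forall>\<alpha>. l \<alpha> = 0")
  case False
  then obtain \<alpha>0 where \<alpha>0: "l \<alpha>0 \<noteq> 0" by blast
  define u where "u i k = l (vec_upd \<alpha>0 i k)" for i k
  have supp: "interval_support (u i)" for i
    unfolding interval_support_def
  proof (intro allI impI notI)
    fix a j b assume "a \<le> j" "j \<le> b" "u i a \<noteq> 0" "u i b \<noteq> 0" and 0: "u i j = 0"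
    then obtain \<gamma> where \<gamma>: "l (vec_upd \<gamma> i j) \<noteq> 0"
      using multiplier_sequence_slices_interval[OF l] unfolding u_def by blast
    \<comment> \<open>Rank one carries the nonzero entry of slice \<open>j\<close> over to the line
      through \<open>\<alpha>0\<close>.\<close>
    have "l (vec_upd \<gamma> i j) * u i a = l (vec_upd \<gamma> i a) * u i j"
      unfolding u_def by (rule multiplier_sequence_rank_one[OF l])
    then show False using \<gamma> 0 \<open>u i a \<noteq> 0\<close> by simp
  qed
  have two: "u i k * u i (Suc (Suc k)) \<ge> 0" for i k
  proof -
    have "vec_upd \<alpha>0 i k + axis i 1 + axis i 1 = vec_upd \<alpha>0 i (Suc (Suc k))"
      by (auto simp: vec_eq_iff axis_def)
    then show ?thesis using multiplier_sequence_sign[OF l, of "vec_upd \<alpha>0 i k" i i] by (simp add: u_def)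
  qed
  have adj: "(u i a * u i (Suc a)) * (u j b * u j (Suc b)) \<ge> 0" for i j a b
  proof (cases "i = j")
    case True
    then show ?thesis using interval_support_adjacent_products[OF supp two] by simp
  next
    case False
    \<comment> \<open>Entries of the plane in directions \<open>i\<close> and \<open>j\<close>
      become products of entries of two lines; the sign test is then applied to a diagonal step in
      that plane.\<close>
    have rank: "l (vec_upd (vec_upd \<alpha>0 i a) j b) * l \<alpha>0 = u i a * u j b" for a b
    proof -
      have "l (vec_upd (vec_upd \<alpha>0 i a) j b) * l (vec_upd \<alpha>0 j (\<alpha>0 $ j)) =
          l (vec_upd (vec_upd \<alpha>0 i a) j (\<alpha>0 $ j)) * l (vec_upd \<alpha>0 j b)"
        by (rule multiplier_sequence_rank_one[OF l])
      moreover have "vec_upd (vec_upd \<alpha>0 i a) j (\<alpha>0 $ j) = vec_upd \<alpha>0 i a"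
        using False by (auto simp: vec_eq_iff)
      ultimately show ?thesis by (simp add: u_def)
    qed
    have "vec_upd (vec_upd \<alpha>0 i a) j b + axis i 1 + axis j 1 = vec_upd (vec_upd \<alpha>0 i (Suc a)) j (Suc b)"
      using False by (auto simp: vec_eq_iff axis_def)
    then have "l (vec_upd (vec_upd \<alpha>0 i a) j b) * l (vec_upd (vec_upd \<alpha>0 i (Suc a)) j (Suc b)) \<ge> 0"
      using multiplier_sequence_sign[OF l, of "vec_upd (vec_upd \<alpha>0 i a) j b" i j] by simp
    then have "(l (vec_upd (vec_upd \<alpha>0 i a) j b) * l (vec_upd (vec_upd \<alpha>0 i (Suc a)) j (Suc b))) * (l \<alpha>0 * l \<alpha>0) \<ge> 0"
      by (rule mult_nonneg_nonneg) (rule zero_le_square)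
    also have "(l (vec_upd (vec_upd \<alpha>0 i a) j b) * l (vec_upd (vec_upd \<alpha>0 i (Suc a)) j (Suc b))) * (l \<alpha>0 * l \<alpha>0) =
        (l (vec_upd (vec_upd \<alpha>0 i a) j b) * l \<alpha>0) * (l (vec_upd (vec_upd \<alpha>0 i (Suc a)) j (Suc b)) * l \<alpha>0)"
      by simp
    finally show ?thesis unfolding rank by (simp add: mult_ac)
  qed
  \<comment> \<open>All denominators combine to squares, so the sign is determined by pairs of
    entries on single lines.\<close>
  have lu: "l \<alpha> * l \<beta> = (l \<alpha>0)\<^sup>2 * (\<Prod>i\<in>UNIV. u i (\<alpha> $ i) * u i (\<beta> $ i) / (l \<alpha>0)\<^sup>2)" for \<alpha> \<beta>
    unfolding multiplier_sequence_product[OF l \<alpha>0, of \<alpha>] multiplier_sequence_product[OF l \<alpha>0, of \<beta>] u_def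
    by (simp add: power2_eq_square mult_ac flip: prod.distrib)
  consider "\<And>i a. u i a * u i (Suc a) \<ge> 0" | "\<And>i a. u i a * u i (Suc a) \<le> 0"
  proof (cases "\<exists>i a. u i a * u i (Suc a) > 0")
    case True
    then obtain i a where "u i a * u i (Suc a) > 0" by blast
    then have "u j b * u j (Suc b) \<ge> 0" for j b
      using adj[of i a j b] by (simp add: zero_le_mult_iff)
    then show ?thesis using that by blast
  next
    case False
    then show ?thesis using that by (meson linorder_not_less)
  qed
  then show ?thesis
  proof cases
    case 1
    have "l \<alpha> * l \<beta> \<ge> 0" for \<alpha> \<beta>
      unfolding lu
      by (intro mult_nonneg_nonneg prod_nonneg divide_nonneg_nonneg interval_support_same_sign[OF supp 1]) auto
    then show ?thesis by blast
  next
    case 2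
    let ?v = "\<lambda>i k. (-1) ^ k * u i k"
    have same: "?v i k * ?v i k' \<ge> 0" for i k k'
    proof (rule interval_support_same_sign[where f = "?v i"])
      show "interval_support (?v i)" using supp[of i] by (simp add: interval_support_def)
      show "?v i k * ?v i (Suc k) \<ge> 0" for k
        using 2[of i k] by (simp add: mult_ac)
    qed
    have "(-1) ^ (index_size \<alpha> + index_size \<beta>) * l \<alpha> * l \<beta> \<ge> 0" for \<alpha> \<beta>
    proof -
      have "(-1) ^ (index_size \<alpha> + index_size \<beta>) = (\<Prod>i\<in>UNIV. (-1) ^ (\<alpha> $ i) * (-1) ^ (\<beta> $ i) :: real)"
        by (simp add: index_size_def power_add power_sum prod.distrib)
      then have "(-1) ^ (index_size \<alpha> + index_size \<beta>) * (l \<alpha> * l \<beta>) =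
          (l \<alpha>0)\<^sup>2 * (\<Prod>i\<in>UNIV. ?v i (\<alpha> $ i) * ?v i (\<beta> $ i) / (l \<alpha>0)\<^sup>2)"
        unfolding lu by (simp add: mult_ac flip: prod.distrib)
      also have "\<dots> \<ge> 0"
        by (intro mult_nonneg_nonneg[OF _ prod_nonneg] divide_nonneg_nonneg same ballI) auto
      finally show ?thesis by (simp only: mult.assoc)
    qed
    then show ?thesis by blast
  qed
qed simp

section \<open>Sufficiency, and the equivalence\<close>

lemma multiplier_sequence_zero: "multiplier_sequence (\<lambda>\<alpha>. 0)"
  by (simp add: multiplier_sequence_iff)

text \<open>Freezing all coordinates but one at an index where no factor vanishes passes the sign
  condition from the product to each factor.\<close>

lemma product_multiplier_sequence_nonneg_products:
  fixes m :: "'n::finite \<Rightarrow> nat \<Rightarrow> real"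
  assumes m: "\<And>i. univariate_multiplier_sequence (m i)"
    and sgn: "\<And>\<alpha> \<beta> :: nat ^ 'n. (\<Prod>i\<in>UNIV. m i (\<alpha> $ i)) * (\<Prod>i\<in>UNIV. m i (\<beta> $ i)) \<ge> 0"
  shows "multiplier_sequence (\<lambda>\<alpha>. \<Prod>i\<in>UNIV. m i (\<alpha> $ i))"
proof (cases "\<forall>\<alpha> :: nat ^ 'n. (\<Prod>i\<in>UNIV. m i (\<alpha> $ i)) = 0")
  case True
  then have "(\<lambda>\<alpha> :: nat ^ 'n. \<Prod>i\<in>UNIV. m i (\<alpha> $ i)) = (\<lambda>\<alpha>. 0)" by (intro ext) blast
  then show ?thesis by (simp only: multiplier_sequence_zero)
next
  case False
  then obtain \<alpha>0 :: "nat ^ 'n" where \<alpha>0: "\<And>i. m i (\<alpha>0 $ i) \<noteq> 0" by auto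
  have "m i k * m i k' \<ge> 0" for i k k'
  proof -
    let ?q = "\<Prod>j\<in>UNIV - {i}. m j (\<alpha>0 $ j)"
    have upd: "(\<Prod>j\<in>UNIV. m j (vec_upd \<alpha>0 i k $ j)) = m i k * ?q" for k
      by (subst prod.remove[of _ i]) auto
    have "(m i k * m i k') * (?q * ?q) \<ge> 0"
      using sgn[of "vec_upd \<alpha>0 i k" "vec_upd \<alpha>0 i k'"] unfolding upd by (simp only: mult_ac)
    moreover have "?q \<noteq> 0" using \<alpha>0 by simp
    then have "?q * ?q > 0" using not_real_square_gt_zero by blast
    ultimately show ?thesis using zero_le_mult_iff[of "m i k * m i k'" "?q * ?q"] by linarith
  qed
  then show ?thesis by (rule product_multiplier_sequence[OF m])
qed

theorem theorem1p8:
  fixes l :: "nat ^ 'n::finite \<Rightarrow> real"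
  shows "multiplier_sequence l \<longleftrightarrow>
    (\<exists>m :: 'n \<Rightarrow> nat \<Rightarrow> real.
       (\<forall>i. univariate_multiplier_sequence (m i)) \<and>
       (\<forall>\<alpha>. l \<alpha> = (\<Prod>i\<in>UNIV. m i (\<alpha> $ i))) \<and>
       ((\<forall>\<alpha> \<beta>. l \<alpha> * l \<beta> \<ge> 0) \<or>
        (\<forall>\<alpha> \<beta>. (-1) ^ (index_size \<alpha> + index_size \<beta>) * l \<alpha> * l \<beta> \<ge> 0)))"
    (is "_ \<longleftrightarrow> (\<exists>m. ?univ m \<and> ?prod m \<and> ?sign)")
proof
  assume l: "multiplier_sequence l"
  have "\<exists>m. ?univ m \<and> ?prod m"
  proof (cases "\<forall>\<alpha>. l \<alpha> = 0")
    case True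
    then have "?prod (\<lambda>i k. 0)" by simp
    moreover have "?univ (\<lambda>i k. 0)"
      by (simp add: univariate_multiplier_sequence_def multiplier_sequence_zero)
    ultimately show ?thesis by (intro exI[of _ "\<lambda>i k. 0"] conjI)
  next
    case False
    then obtain \<alpha>0 where \<alpha>0: "l \<alpha>0 \<noteq> 0" by blast
    \<comment> \<open>An arbitrary direction, whose factor absorbs the constant
      \<open>l \<alpha>0\<close> of the product formula.\<close>
    define i0 :: 'n where "i0 = undefined"
    define c where "c i = (if i = i0 then l \<alpha>0 else 1) / l \<alpha>0" for i
    define m where "m i k = c i * l (vec_upd \<alpha>0 i k)" for i k
    have "?univ m"
      using multiplier_sequence_scale[OF univariate_multiplier_sequence_slice[OF l, unfolded univariate_multiplier_sequence_def]]
      by (simp add: univariate_multiplier_sequence_def m_def)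
    moreover have "?prod m"
    proof
      fix \<alpha>
      have "(\<Prod>i\<in>UNIV. m i (\<alpha> $ i)) =
          (\<Prod>i\<in>UNIV. if i = i0 then l \<alpha>0 else 1) * (\<Prod>i\<in>UNIV. l (vec_upd \<alpha>0 i (\<alpha> $ i)) / l \<alpha>0)"
        unfolding m_def c_def prod.distrib[symmetric] by simp
      also have "(\<Prod>i\<in>UNIV. if i = i0 then l \<alpha>0 else 1) = l \<alpha>0" by simp
      finally show "l \<alpha> = (\<Prod>i\<in>UNIV. m i (\<alpha> $ i))"
        using multiplier_sequence_product[OF l \<alpha>0, of \<alpha>] by simp
    qed
    ultimately show ?thesis by blast
  qed
  then show "\<exists>m. ?univ m \<and> ?prod m \<and> ?sign"
    using multiplier_sequence_signs[OF l] by blast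
next
  assume "\<exists>m. ?univ m \<and> ?prod m \<and> ?sign"
  then obtain m where univ: "?univ m" and lm: "?prod m" and sgn: ?sign by blast
  have l_eq: "l = (\<lambda>\<alpha>. \<Prod>i\<in>UNIV. m i (\<alpha> $ i))" using lm by (intro ext) blast
  from sgn show "multiplier_sequence l"
  proof
    assume "\<forall>\<alpha> \<beta>. l \<alpha> * l \<beta> \<ge> 0"
    then show ?thesis
      unfolding l_eq by (intro product_multiplier_sequence_nonneg_products) (use univ in auto)
  next
    assume alt: "\<forall>\<alpha> \<beta>. (-1) ^ (index_size \<alpha> + index_size \<beta>) * l \<alpha> * l \<beta> \<ge> 0"
    \<comment> \<open>Alternating each factor turns the second sign condition into the first;
      alternating the product once more recovers \<open>l\<close>.\<close>
    define m' where "m' i k = (-1) ^ k * m i k" for i k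
    have m': "(\<Prod>i\<in>UNIV. m' i (\<alpha> $ i)) = (-1) ^ index_size \<alpha> * l \<alpha>" for \<alpha>
      by (simp add: m'_def l_eq prod.distrib index_size_def power_sum)
    have "multiplier_sequence (\<lambda>\<alpha>. \<Prod>i\<in>UNIV. m' i (\<alpha> $ i))"
    proof (rule product_multiplier_sequence_nonneg_products)
      show "univariate_multiplier_sequence (m' i)" for i
        unfolding m'_def using univ by (intro univariate_multiplier_sequence_alternate) blast
      show "(\<Prod>i\<in>UNIV. m' i (\<alpha> $ i)) * (\<Prod>i\<in>UNIV. m' i (\<beta> $ i)) \<ge> 0" for \<alpha> \<beta> :: "nat ^ 'n"
        using alt[rule_format, of \<alpha> \<beta>] unfolding m' by (simp add: power_add mult_ac)
    qed
    then have "multiplier_sequence (\<lambda>\<alpha>. (-1) ^ index_size \<alpha> * ((-1) ^ index_size \<alpha> * l \<alpha>))"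
      unfolding m' by (rule multiplier_sequence_alternate)
    then show ?thesis by (simp flip: mult.assoc power_add)
  qed
qed

end
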